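(* Let $G$ be an infinite, finitely generated, residually finite group. Let $I(G)$ be the set of all natural numbers $i$ such that $r_i(G)=\infty$. The following are equivalent: (i) $I(G)$ is finite and non-empty; (ii) $r_i(G)=0$ for all sufficiently large $i$; (iii) $G$ is virtually abelian.
   Context: For a finitely generated, residually finite group $G$, $r_n(G)$ (possibly $\infty$) denotes the number of inequivalent complex irreducible representations of $G$ of dimension $n$ whose kernels have finite index in $G$. Natural numbers here are the positive integers. *)

theory Defs
  imports
    "HOL-Algebra.Algebra"
    "HOL-Library.Extended_Nat"
    "Jordan_Normal_Form.VS_Connect"
begin

definition finite_index :: "('a, 'b) monoid_scheme \<Rightarrow> 'a set \<Rightarrow> bool" where
  "finite_index G H \<longleftrightarrow> subgroup H G \<and> finite (rcosets\<^bsub>G\<^esub> H)"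

definition finitely_generated :: "('a, 'b) monoid_scheme \<Rightarrow> bool" where
  "finitely_generated G \<longleftrightarrow> (\<exists>S. finite S \<and> S \<subseteq> carrier G \<and> generate G S = carrier G)"

definition residually_finite :: "('a, 'b) monoid_scheme \<Rightarrow> bool" where
  "residually_finite G \<longleftrightarrow>
     (\<forall>g \<in> carrier G - {\<one>\<^bsub>G\<^esub>}. \<exists>N. N \<lhd> G \<and> finite_index G N \<and> g \<notin> N)"

definition virtually_abelian :: "('a, 'b) monoid_scheme \<Rightarrow> bool" where
  "virtually_abelian G \<longleftrightarrow> (\<exists>H. finite_index G H \<and> comm_group (G\<lparr>carrier := H\<rparr>))"

definition GL :: "nat \<Rightarrow> complex mat monoid" where
  "GL n = units_of (ring_mat TYPE(complex) n ())"

definition invariant_subspace ::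
    "('a, 'b) monoid_scheme \<Rightarrow> nat \<Rightarrow> ('a \<Rightarrow> complex mat) \<Rightarrow> complex vec set \<Rightarrow> bool" where
  "invariant_subspace G n \<rho> W \<longleftrightarrow>
     VectorSpace.subspace class_ring W (module_vec TYPE(complex) n) \<and>
     (\<forall>g \<in> carrier G. \<forall>w \<in> W. \<rho> g *\<^sub>v w \<in> W)"

text \<open>The zero representation (\<open>n = 0\<close>) is not irreducible.\<close>

definition irreducible_rep ::
    "('a, 'b) monoid_scheme \<Rightarrow> nat \<Rightarrow> ('a \<Rightarrow> complex mat) \<Rightarrow> bool" where
  "irreducible_rep G n \<rho> \<longleftrightarrow>
     \<rho> \<in> hom G (GL n) \<and> 0 < n \<and>
     (\<forall>W. invariant_subspace G n \<rho> W \<longrightarrow> W = {0\<^sub>v n} \<or> W = carrier_vec n)"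

definition finite_irreps :: "('a, 'b) monoid_scheme \<Rightarrow> nat \<Rightarrow> ('a \<Rightarrow> complex mat) set" where
  "finite_irreps G n =
     {\<rho>. irreducible_rep G n \<rho> \<and> finite_index G (kernel G (GL n) \<rho>)}"

text \<open>
  The values of a representation outside \<open>carrier G\<close> are unspecified. Intertwining is
  required on \<open>carrier G\<close> only, so representations that agree there are equivalent and
  are counted once.
\<close>

definition rep_equivalence ::
    "('a, 'b) monoid_scheme \<Rightarrow> nat \<Rightarrow> (('a \<Rightarrow> complex mat) \<times> ('a \<Rightarrow> complex mat)) set" where
  "rep_equivalence G n =
     {(\<rho>, \<sigma>). \<rho> \<in> finite_irreps G n \<and> \<sigma> \<in> finite_irreps G n \<and>
        (\<exists>T \<in> carrier (GL n). \<forall>g \<in> carrier G. T * \<rho> g = \<sigma> g * T)}"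

definition ecard :: "'a set \<Rightarrow> enat" where
  "ecard A = (if finite A then enat (card A) else \<infinity>)"

definition num_irreps :: "('a, 'b) monoid_scheme \<Rightarrow> nat \<Rightarrow> enat" where
  "num_irreps G n = ecard (finite_irreps G n // rep_equivalence G n)"

definition infinite_degrees :: "('a, 'b) monoid_scheme \<Rightarrow> nat set" where
  "infinite_degrees G = {i. 1 \<le> i \<and> num_irreps G i = \<infinity>}"

lemma group_GL: "Group.group (GL n)"
  unfolding GL_def by (rule monoid.units_group) (rule semiring.axioms(2)[OF semiring_mat])

lemma GL_mult [simp]: "x \<otimes>\<^bsub>GL n\<^esub> y = x * y"
  by (simp add: GL_def units_of_def ring_mat_simps)

lemma GL_one [simp]: "\<one>\<^bsub>GL n\<^esub> = 1\<^sub>m n"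
  by (simp add: GL_def units_of_def ring_mat_simps)

lemma carrier_GL: "carrier (GL n) = {A \<in> carrier_mat n n. invertible_mat A}"
proof -
  have "invertible_mat A \<longleftrightarrow> (\<exists>B\<in>carrier_mat n n. B * A = 1\<^sub>m n \<and> A * B = 1\<^sub>m n)"
    if A: "A \<in> carrier_mat n n" for A :: "complex mat"
  proof
    assume "invertible_mat A"
    then obtain B where B: "A * B = 1\<^sub>m (dim_row A)" "B * A = 1\<^sub>m (dim_row B)"
      unfolding invertible_mat_def inverts_mat_def by blast
    have "dim_col (A * B) = n" "dim_col (B * A) = dim_row B"
      using A B by simp_all
    then have "B \<in> carrier_mat n n" using A by (intro carrier_matI) auto
    then show "\<exists>B\<in>carrier_mat n n. B * A = 1\<^sub>m n \<and> A * B = 1\<^sub>m n"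
      using A B by auto
  next
    assume "\<exists>B\<in>carrier_mat n n. B * A = 1\<^sub>m n \<and> A * B = 1\<^sub>m n"
    then show "invertible_mat A"
      using A unfolding invertible_mat_def inverts_mat_def by auto
  qed
  then show ?thesis
    by (auto simp: GL_def units_of_def Units_def ring_mat_simps)
qed

lemma equiv_rep_equivalence:
  assumes "Group.group G"
  shows "equiv (finite_irreps G n) (rep_equivalence G n)"
proof -
  interpret GL: Group.group "GL n" by (rule group_GL)
  have val: "\<rho> g \<in> carrier (GL n)" if "\<rho> \<in> finite_irreps G n" "g \<in> carrier G" for \<rho> g
    using that by (auto simp: finite_irreps_def irreducible_rep_def hom_def)
  show ?thesis
  proof (rule equivI)
    show "rep_equivalence G n \<subseteq> finite_irreps G n \<times> finite_irreps G n"
      by (auto simp: rep_equivalence_def)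
    show "refl_on (finite_irreps G n) (rep_equivalence G n)"
    proof (rule refl_onI)
      fix \<rho> assume \<rho>: "\<rho> \<in> finite_irreps G n"
      have "\<forall>g \<in> carrier G. \<one>\<^bsub>GL n\<^esub> \<otimes>\<^bsub>GL n\<^esub> \<rho> g = \<rho> g \<otimes>\<^bsub>GL n\<^esub> \<one>\<^bsub>GL n\<^esub>"
        using val[OF \<rho>] by (simp del: GL_mult GL_one)
      then show "(\<rho>, \<rho>) \<in> rep_equivalence G n"
        using \<rho> GL.one_closed unfolding rep_equivalence_def GL_mult by blast
    qed
    show "sym (rep_equivalence G n)"
    proof (rule symI)
      fix \<rho> \<sigma> assume "(\<rho>, \<sigma>) \<in> rep_equivalence G n"
      then obtain T where \<rho>: "\<rho> \<in> finite_irreps G n" and \<sigma>: "\<sigma> \<in> finite_irreps G n"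
        and T: "T \<in> carrier (GL n)"
        and eq: "\<And>g. g \<in> carrier G \<Longrightarrow> T \<otimes>\<^bsub>GL n\<^esub> \<rho> g = \<sigma> g \<otimes>\<^bsub>GL n\<^esub> T"
        unfolding rep_equivalence_def GL_mult by blast
      let ?S = "inv\<^bsub>GL n\<^esub> T"
      have "?S \<otimes>\<^bsub>GL n\<^esub> \<sigma> g = \<rho> g \<otimes>\<^bsub>GL n\<^esub> ?S" if g: "g \<in> carrier G" for g
      proof -
        have "\<rho> g = ?S \<otimes>\<^bsub>GL n\<^esub> (\<sigma> g \<otimes>\<^bsub>GL n\<^esub> T)"
          using GL.inv_solve_left[OF val[OF \<rho> g] T] eq[OF g] val[OF \<sigma> g] T
          by (metis GL.m_closed)
        then show ?thesis
          using T val[OF \<sigma> g] by (simp add: GL.m_assoc del: GL_mult GL_one)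
      qed
      then show "(\<sigma>, \<rho>) \<in> rep_equivalence G n"
        using \<rho> \<sigma> GL.inv_closed[OF T] unfolding rep_equivalence_def GL_mult by blast
    qed
    show "trans (rep_equivalence G n)"
    proof (rule transI)
      fix \<rho> \<sigma> \<tau>
      assume "(\<rho>, \<sigma>) \<in> rep_equivalence G n" "(\<sigma>, \<tau>) \<in> rep_equivalence G n"
      then obtain S T where \<rho>: "\<rho> \<in> finite_irreps G n" and \<sigma>: "\<sigma> \<in> finite_irreps G n"
        and \<tau>: "\<tau> \<in> finite_irreps G n"
        and S: "S \<in> carrier (GL n)" and T: "T \<in> carrier (GL n)"
        and eqS: "\<And>g. g \<in> carrier G \<Longrightarrow> S \<otimes>\<^bsub>GL n\<^esub> \<rho> g = \<sigma> g \<otimes>\<^bsub>GL n\<^esub> S"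
        and eqT: "\<And>g. g \<in> carrier G \<Longrightarrow> T \<otimes>\<^bsub>GL n\<^esub> \<sigma> g = \<tau> g \<otimes>\<^bsub>GL n\<^esub> T"
        unfolding rep_equivalence_def GL_mult by blast
      have "(T \<otimes>\<^bsub>GL n\<^esub> S) \<otimes>\<^bsub>GL n\<^esub> \<rho> g = \<tau> g \<otimes>\<^bsub>GL n\<^esub> (T \<otimes>\<^bsub>GL n\<^esub> S)"
        if g: "g \<in> carrier G" for g
        using GL.m_assoc eqS[OF g] eqT[OF g] S T val[OF \<rho> g] val[OF \<sigma> g] val[OF \<tau> g]
        by metis
      then show "(\<rho>, \<tau>) \<in> rep_equivalence G n"
        using \<rho> \<tau> GL.m_closed[OF T S] unfolding rep_equivalence_def GL_mult by blast
    qed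
  qed
qed

end

theory Submission
  imports
    Defs
    "HOL-Library.Function_Algebras"
    "Jordan_Normal_Form.Spectral_Radius"
begin

text \<open>
  (i) implies (ii): let \<open>k \<in> I(G)\<close>, and let \<open>\<rho>\<close> be irreducible of large degree \<open>n\<close>. For \<open>\<sigma>\<close> irreducible of
  degree \<open>k\<close>, every constituent of \<open>\<rho> \<otimes> \<sigma>\<close> has degree between \<open>n / k\<close> and \<open>n k\<close>. If no degree in this range
  lay in \<open>I(G)\<close>, all these constituents and \<open>\<rho>\<close> would be trivial on a common subgroup \<open>N\<close> of finite index;
  then so would all the \<open>\<sigma>\<close>, which leaves only finitely many of them.

  (ii) implies (i): otherwise there are only finitely many irreducible representations with finite image.
  The intersection of their kernels has finite index, and it is trivial by residual finiteness.

  (ii) implies (iii): if all degrees are below \<open>d\<close>, the standard identity of degree \<open>d\<^sup>2 + 1\<close> holds in the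
  group ring, so every product of \<open>d\<^sup>2 + 1\<close> distinct elements equals the product in some other order.
  By Passman's argument the FC-centre then has finite index. As \<open>G\<close> is finitely generated, so is a subgroup
  of finite index in the FC-centre, and the centralizers of its generators have finite index.

  (iii) implies (ii): an abelian subgroup \<open>H\<close> has a common eigenvector, whose translates by coset
  representatives of \<open>H\<close> span the representation.
\<close>

section \<open>Subgroups of finite index\<close>

text \<open>No decomposition into irreducibles is used: each argument takes one irreducible
  submodule, found by minimal dimension. The role of complete reducibility is played by the positive
  definite form on functions on G/N, that of Schur orthogonality by averaging over cosets.

  The bridge from matrices to group elements: a formal combination killed by all irreducible
  representations with finite image has coefficient sum zero on every coset of N. For 1 - g this
  shows that these representations separate points. For the alternating sum over all orderings of a
  product, with N separating the given ordering from the other values, it forces a coincidence. The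
  length d^2 + 1 exceeds the number k^2 of matrix positions for each degree k < d.

  Eliminating entries may confine them to cosets of the FC-centre, so Passman's induction carries a
  second alternative, a nonempty monomial in the FC-centre.

  In (i) implies (ii), one constituent of \<rho> \<otimes> \<sigma> suffices: its triviality on N
  yields one nonzero N-fixed vector of \<sigma>, and normality of N extends this to the whole
  space.\<close>

context Group.group begin

lemma rcosets_image: "rcosets H = (\<lambda>g. H #> g) ` carrier G"
  by (auto simp: RCOSETS_def)

lemma rcos_eq_iff:
  assumes H: "subgroup H G" and a: "a \<in> carrier G" and b: "b \<in> carrier G"
  shows "H #> a = H #> b \<longleftrightarrow> a \<otimes> inv b \<in> H"
proof
  assume "H #> a = H #> b"
  then have "a \<in> H #> b" using rcos_self[OF a H] by simp
  then show "a \<otimes> inv b \<in> H" using subgroup.rcos_module_imp[OF H is_group b] by simp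
next
  assume "a \<otimes> inv b \<in> H"
  then have "a \<in> H #> b" using subgroup.rcos_module_rev[OF H is_group b a] by simp
  then show "H #> a = H #> b" using repr_independence[OF _ b H] by simp
qed

text \<open>The coset \<open>H #> a\<close> is determined by \<open>f a\<close>, so there are no
  more cosets than values of \<open>f\<close>. Intersections, centralizers and overgroups get finite
  index from a suitable \<open>f\<close>.\<close>

lemma finite_index_if_finite_image:
  assumes H: "subgroup H G" and fin: "finite (f ` carrier G)"
    and f: "\<And>a b. a \<in> carrier G \<Longrightarrow> b \<in> carrier G \<Longrightarrow> f a = f b \<Longrightarrow> a \<otimes> inv b \<in> H"
  shows "finite_index G H"
proof -
  define g where "g y = H #> (SOME a. a \<in> carrier G \<and> f a = y)" for y
  have "H #> a = g (f a)" if a: "a \<in> carrier G" for a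
  proof -
    have "(SOME b. b \<in> carrier G \<and> f b = f a) \<in> carrier G \<and> f (SOME b. b \<in> carrier G \<and> f b = f a) = f a"
      by (rule someI[of _ a]) (use a in auto)
    then show ?thesis unfolding g_def using rcos_eq_iff[OF H a] f[OF a] by metis
  qed
  then have "rcosets H \<subseteq> g ` f ` carrier G" unfolding rcosets_image by auto
  then show ?thesis unfolding finite_index_def using H fin finite_subset by blast
qed

lemma finite_image_if_finite_index:
  assumes H: "finite_index G H"
    and f: "\<And>a b. a \<in> carrier G \<Longrightarrow> b \<in> carrier G \<Longrightarrow> a \<otimes> inv b \<in> H \<Longrightarrow> f a = f b"
  shows "finite (f ` carrier G)"
proof -
  have sub: "subgroup H G" and fin: "finite ((\<lambda>g. H #> g) ` carrier G)"
    using H unfolding finite_index_def rcosets_image by auto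
  define g where "g C = f (SOME a. a \<in> carrier G \<and> H #> a = C)" for C
  have "f a = g (H #> a)" if a: "a \<in> carrier G" for a
  proof -
    have "(SOME b. b \<in> carrier G \<and> H #> b = H #> a) \<in> carrier G \<and>
        H #> (SOME b. b \<in> carrier G \<and> H #> b = H #> a) = H #> a"
      by (rule someI[of _ a]) (use a in auto)
    then show ?thesis unfolding g_def using rcos_eq_iff[OF sub a] f[OF a] by metis
  qed
  then have "f ` carrier G \<subseteq> g ` (\<lambda>g. H #> g) ` carrier G" by auto
  then show ?thesis using fin finite_subset by blast
qed

lemma finite_index_Int:
  assumes "finite_index G H" "finite_index G K"
  shows "finite_index G (H \<inter> K)"
proof (rule finite_index_if_finite_image[where f = "\<lambda>a. (H #> a, K #> a)"])
  have s: "subgroup H G" "subgroup K G" using assms by (auto simp: finite_index_def)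
  then show "subgroup (H \<inter> K) G" by (rule subgroups_Inter_pair)
  have "(\<lambda>a. (H #> a, K #> a)) ` carrier G \<subseteq> (rcosets H) \<times> (rcosets K)"
    unfolding rcosets_image by auto
  then show "finite ((\<lambda>a. (H #> a, K #> a)) ` carrier G)"
    using assms finite_subset unfolding finite_index_def by blast
  show "\<And>a b. a \<in> carrier G \<Longrightarrow> b \<in> carrier G \<Longrightarrow> (H #> a, K #> a) = (H #> b, K #> b) \<Longrightarrow> a \<otimes> inv b \<in> H \<inter> K"
    using rcos_eq_iff s by auto
qed

lemma finite_index_carrier: "finite_index G (carrier G)"
  by (rule finite_index_if_finite_image[where f = "\<lambda>_. ()"]) (auto simp: subgroup_self)

text \<open>Intersecting with \<open>carrier G\<close> gives the empty family the right
  value.\<close>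

lemma finite_index_INT:
  assumes "finite I" "\<And>i. i \<in> I \<Longrightarrow> finite_index G (H i)"
  shows "finite_index G (carrier G \<inter> (\<Inter>i\<in>I. H i))"
  using assms
proof (induction I rule: finite_induct)
  case empty
  then show ?case by (simp add: finite_index_carrier)
next
  case (insert i I)
  then have "finite_index G (H i \<inter> (carrier G \<inter> (\<Inter>i\<in>I. H i)))" by (simp add: finite_index_Int)
  moreover have "H i \<inter> (carrier G \<inter> (\<Inter>i\<in>I. H i)) = carrier G \<inter> (\<Inter>i\<in>insert i I. H i)" by auto
  ultimately show ?case by simp
qed

lemma normal_INT:
  assumes "\<And>i. i \<in> I \<Longrightarrow> H i \<lhd> G"
  shows "carrier G \<inter> (\<Inter>i\<in>I. H i) \<lhd> G"
proof -
  have s: "\<And>i. i \<in> I \<Longrightarrow> subgroup (H i) G" using assms normal_imp_subgroup by blast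
  show ?thesis unfolding normal_inv_iff
  proof (intro conjI ballI)
    show "subgroup (carrier G \<inter> (\<Inter>i\<in>I. H i)) G"
      using s
        by (intro subgroup.intro) (auto dest: subgroup.m_closed subgroup.one_closed subgroup.m_inv_closed)
    fix x h assume "x \<in> carrier G" "h \<in> carrier G \<inter> (\<Inter>i\<in>I. H i)"
    then show "x \<otimes> h \<otimes> inv x \<in> carrier G \<inter> (\<Inter>i\<in>I. H i)"
      using assms unfolding normal_inv_iff by auto
  qed
qed

section \<open>Coverings by cosets\<close>

text \<open>B. H. Neumann's lemma. If some coset of \<open>H\<close> is not among the listed ones, the cosets of
  the other subgroups cover it, hence their translates cover every coset of \<open>H\<close>.\<close>

lemma coset_cover:
  assumes "finite \<H>" "\<And>H. H \<in> \<H> \<Longrightarrow> subgroup H G"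
    and "finite F" "F \<subseteq> carrier G" "carrier G \<subseteq> (\<Union>H\<in>\<H>. \<Union>f\<in>F. H #> f)"
  shows "\<exists>H\<in>\<H>. finite_index G H"
  using assms
proof (induction \<H> arbitrary: F rule: finite_induct)
  case empty
  then show ?case by auto
next
  case (insert H \<H>)
  have sH: "subgroup H G" using insert.prems by simp
  show ?case
  proof (cases "rcosets H \<subseteq> (\<lambda>f. H #> f) ` F")
    case True
    then have "finite (rcosets H)" using insert.prems(2) finite_imageI finite_subset by metis
    then show ?thesis using sH by (simp add: finite_index_def)
  next
    case False
    then obtain g where g: "g \<in> carrier G" "H #> g \<notin> (\<lambda>f. H #> f) ` F"
      unfolding rcosets_image by blast
    have cov: "H #> g \<subseteq> (\<Union>K\<in>\<H>. \<Union>f\<in>F. K #> f)"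
    proof
      fix x assume x: "x \<in> H #> g"
      then have xG: "x \<in> carrier G" using sH g by (meson r_coset_subset_G subgroup.subset subsetD)
      then obtain K f where K: "K \<in> insert H \<H>" "f \<in> F" "x \<in> K #> f" using insert.prems(4) by blast
      have "K \<noteq> H"
      proof
        assume "K = H"
        then have "H #> f = H #> g"
          using K x repr_independence[OF _ _ sH] g insert.prems(3) by (metis subsetD)
        then show False using g K by blast
      qed
      then show "x \<in> (\<Union>K\<in>\<H>. \<Union>f\<in>F. K #> f)" using K by blast
    qed
    \<comment> \<open>A point \<open>x = h \<otimes> f\<close> of a coset of \<open>H\<close> is
      moved into \<open>H #> g\<close>, where \<open>h \<otimes> g = l \<otimes> f'\<close>. Hence
      \<open>x = l \<otimes> (f' \<otimes> inv g \<otimes> f)\<close>, and these products are the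
      additional representatives.\<close>
    define F' where "F' = F \<union> (\<lambda>(f, f'). f \<otimes> inv g \<otimes> f') ` (F \<times> F)"
    have F': "finite F'" "F' \<subseteq> carrier G" using insert.prems g by (auto simp: F'_def)
    have "carrier G \<subseteq> (\<Union>K\<in>\<H>. \<Union>f\<in>F'. K #> f)"
    proof
      fix x assume xG: "x \<in> carrier G"
      then obtain K f where K: "K \<in> insert H \<H>" "f \<in> F" "x \<in> K #> f" using insert.prems(4) by blast
      show "x \<in> (\<Union>K\<in>\<H>. \<Union>f\<in>F'. K #> f)"
      proof (cases "K = H")
        case False
        then show ?thesis using K by (auto simp: F'_def)
      next
        case True
        have f: "f \<in> carrier G" using K insert.prems by auto
        obtain h where h: "h \<in> H" "x = h \<otimes> f" using K True by (auto simp: r_coset_def)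
        have hG: "h \<in> carrier G" using h sH by (meson subgroup.mem_carrier)
        have "h \<otimes> g \<in> H #> g" using h by (auto simp: r_coset_def)
        then obtain L f' l where L: "L \<in> \<H>" "f' \<in> F" "l \<in> L" "h \<otimes> g = l \<otimes> f'"
          using cov by (auto simp: r_coset_def)
        have lG: "l \<in> carrier G" "f' \<in> carrier G"
          using L insert.prems by (auto intro: subgroup.mem_carrier)
        have "h = l \<otimes> f' \<otimes> inv g" using L(4) hG g by (metis inv_solve_right lG m_closed)
        then have "x = l \<otimes> (f' \<otimes> inv g \<otimes> f)" using h lG g f by (simp add: m_assoc)
        moreover have "f' \<otimes> inv g \<otimes> f \<in> F'" using L K by (force simp: F'_def)
        ultimately show ?thesis using L by (auto simp: r_coset_def)
      qed
    qed
    then have "\<exists>H\<in>\<H>. finite_index G H" using insert.IH[OF _ F'] insert.prems by blast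
    then show ?thesis by blast
  qed
qed

section \<open>The FC-centre\<close>

definition centralizer :: "'a \<Rightarrow> 'a set" where
  "centralizer x = {g \<in> carrier G. g \<otimes> x = x \<otimes> g}"

text \<open>Conjugating as \<open>inv g \<otimes> x \<otimes> g\<close> makes the fibres of
  conjugation right cosets of the centralizer, the cosets that \<open>finite_index\<close>
  counts.\<close>

definition conj_class :: "'a \<Rightarrow> 'a set" where
  "conj_class x = (\<lambda>g. inv g \<otimes> x \<otimes> g) ` carrier G"

definition FC_centre :: "'a set" where
  "FC_centre = {x \<in> carrier G. finite (conj_class x)}"

lemma subgroup_centralizer: 
  assumes x: "x \<in> carrier G" shows "subgroup (centralizer x) G"
proof (rule subgroupI)
  show "centralizer x \<subseteq> carrier G" "centralizer x \<noteq> {}"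
    using x by (auto simp: centralizer_def intro!: exI[of _ \<one>])
  show "inv a \<in> centralizer x" if "a \<in> centralizer x" for a
  proof -
    have a: "a \<in> carrier G" "a \<otimes> x = x \<otimes> a" using that by (auto simp: centralizer_def)
    then have "x = inv a \<otimes> (x \<otimes> a)" using x by (metis inv_solve_left m_closed)
    then have "x \<otimes> inv a = inv a \<otimes> x" using a x
      by (metis inv_closed inv_solve_right m_assoc m_closed)
    then show ?thesis using a by (simp add: centralizer_def)
  qed
  show "a \<otimes> b \<in> centralizer x" if "a \<in> centralizer x" "b \<in> centralizer x" for a b
    using that x unfolding centralizer_def by (auto simp: m_assoc) (metis m_assoc)
qed

lemma conj_eq_iff:
  assumes x: "x \<in> carrier G" and a: "a \<in> carrier G" and b: "b \<in> carrier G"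
  shows "inv a \<otimes> x \<otimes> a = inv b \<otimes> x \<otimes> b \<longleftrightarrow> a \<otimes> inv b \<in> centralizer x"
proof -
  have "inv a \<otimes> x \<otimes> a = inv b \<otimes> x \<otimes> b \<longleftrightarrow> a \<otimes> (inv a \<otimes> x \<otimes> a) \<otimes> inv b = a \<otimes> (inv b \<otimes> x \<otimes> b) \<otimes> inv b"
    using assms by simp
  also have "a \<otimes> (inv a \<otimes> x \<otimes> a) \<otimes> inv b = x \<otimes> (a \<otimes> inv b)"
    using assms by (simp add: m_assoc[symmetric])
  also have "a \<otimes> (inv b \<otimes> x \<otimes> b) \<otimes> inv b = (a \<otimes> inv b) \<otimes> x"
    using assms by (simp add: m_assoc)
  finally show ?thesis using assms by (auto simp: centralizer_def)
qed

lemma finite_index_centralizer_iff: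
  assumes x: "x \<in> carrier G"
  shows "finite_index G (centralizer x) \<longleftrightarrow> x \<in> FC_centre"
proof
  assume "finite_index G (centralizer x)"
  then have "finite (conj_class x)" unfolding conj_class_def
    by (rule finite_image_if_finite_index) (simp add: conj_eq_iff x)
  then show "x \<in> FC_centre" using x by (simp add: FC_centre_def)
next
  assume "x \<in> FC_centre"
  then have "finite (conj_class x)" by (simp add: FC_centre_def)
  then show "finite_index G (centralizer x)" unfolding conj_class_def
    by (rule finite_index_if_finite_image[OF subgroup_centralizer[OF x]]) (simp add: conj_eq_iff x)
qed

text \<open>The class of a product lies in the product of the two classes, inversion carries classes
  to classes, and conjugate elements share their class.\<close>

lemma normal_FC_centre: "FC_centre \<lhd> G"
  unfolding normal_inv_iff
proof (intro conjI ballI)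
  show "subgroup FC_centre G"
  proof (rule subgroupI)
    show "FC_centre \<subseteq> carrier G" by (auto simp: FC_centre_def)
    have "conj_class \<one> \<subseteq> {\<one>}" by (auto simp: conj_class_def)
    then have "\<one> \<in> FC_centre" using finite_subset by (auto simp: FC_centre_def)
    then show "FC_centre \<noteq> {}" by auto
  next
    fix a assume a: "a \<in> FC_centre"
    have "conj_class (inv a) \<subseteq> m_inv G ` conj_class a"
    proof
      fix y assume "y \<in> conj_class (inv a)"
      then obtain g where g: "g \<in> carrier G" "y = inv g \<otimes> inv a \<otimes> g" by (auto simp: conj_class_def)
      then have "y = inv (inv g \<otimes> a \<otimes> g)" using a by (simp add: FC_centre_def inv_mult_group m_assoc)
      then show "y \<in> m_inv G ` conj_class a" using g by (auto simp: conj_class_def)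
    qed
    then show "inv a \<in> FC_centre" using a finite_subset by (auto simp: FC_centre_def)
  next
    fix a b assume a: "a \<in> FC_centre" and b: "b \<in> FC_centre"
    have "conj_class (a \<otimes> b) \<subseteq> (\<lambda>(x, y). x \<otimes> y) ` (conj_class a \<times> conj_class b)"
    proof
      fix y assume "y \<in> conj_class (a \<otimes> b)"
      then obtain g where g: "g \<in> carrier G" "y = inv g \<otimes> (a \<otimes> b) \<otimes> g" by (auto simp: conj_class_def)
      have ab: "a \<in> carrier G" "b \<in> carrier G" using a b by (auto simp: FC_centre_def)
      have "g \<otimes> (inv g \<otimes> z) = z" if "z \<in> carrier G" for z
        using that g by (simp add: m_assoc[symmetric])
      then have "y = (inv g \<otimes> a \<otimes> g) \<otimes> (inv g \<otimes> b \<otimes> g)"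
        using g ab by (simp add: m_assoc)
      then show "y \<in> (\<lambda>(x, y). x \<otimes> y) ` (conj_class a \<times> conj_class b)"
        using g by (intro image_eqI[of _ _ "(inv g \<otimes> a \<otimes> g, inv g \<otimes> b \<otimes> g)"]) (auto simp: conj_class_def)
    qed
    then have "finite (conj_class (a \<otimes> b))"
      using a b by (auto simp: FC_centre_def intro: finite_subset)
    then show "a \<otimes> b \<in> FC_centre" using a b by (simp add: FC_centre_def)
  qed
next
  fix x h assume x: "x \<in> carrier G" and h: "h \<in> FC_centre"
  then have hG: "h \<in> carrier G" by (simp add: FC_centre_def)
  have "conj_class (x \<otimes> h \<otimes> inv x) \<subseteq> conj_class h"
  proof
    fix y assume "y \<in> conj_class (x \<otimes> h \<otimes> inv x)"
    then obtain g where g: "g \<in> carrier G" "y = inv g \<otimes> (x \<otimes> h \<otimes> inv x) \<otimes> g"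
      by (auto simp: conj_class_def)
    then have "y = inv (inv x \<otimes> g) \<otimes> h \<otimes> (inv x \<otimes> g)"
      using x hG by (simp add: m_assoc inv_mult_group)
    then show "y \<in> conj_class h" using g x by (auto simp: conj_class_def)
  qed
  then show "x \<otimes> h \<otimes> inv x \<in> FC_centre" using x h finite_subset by (auto simp: FC_centre_def)
qed

section \<open>Groups in which products can be reordered\<close>

definition list_prod :: "'a list \<Rightarrow> 'a" where
  "list_prod xs = foldr (\<otimes>) xs \<one>"

lemma list_prod_simps [simp]:
  "list_prod [] = \<one>" "list_prod (x # xs) = x \<otimes> list_prod xs"
  by (simp_all add: list_prod_def)

lemma list_prod_closed [simp]: "set xs \<subseteq> carrier G \<Longrightarrow> list_prod xs \<in> carrier G"
  by (induction xs) auto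

lemma list_prod_append:
  "set xs \<subseteq> carrier G \<Longrightarrow> set ys \<subseteq> carrier G \<Longrightarrow> list_prod (xs @ ys) = list_prod xs \<otimes> list_prod ys"
  by (induction xs) (auto simp: m_assoc)

text \<open>For distinct \<open>xs\<close>, the competing lists \<open>ys\<close> are exactly the
  nontrivial permutations of \<open>xs\<close>.\<close>

definition reorderable :: "'a list \<Rightarrow> bool" where
  "reorderable xs \<longleftrightarrow> (\<exists>ys. distinct ys \<and> set ys = set xs \<and> ys \<noteq> xs \<and> list_prod ys = list_prod xs)"

text \<open>The empty word is excluded because \<open>\<one>\<close> always lies in
  \<open>FC_centre\<close>.\<close>

definition has_FC_monomial :: "'a list \<Rightarrow> bool" where
  "has_FC_monomial xs \<longleftrightarrow>
     (\<exists>ys. distinct ys \<and> ys \<noteq> [] \<and> set ys \<subseteq> set xs \<and> list_prod ys \<in> FC_centre)"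

text \<open>The first entry \<open>x\<close> of the list is eliminated: for fixed remaining entries, a reordering that
  moves \<open>x\<close> behind a monomial \<open>m\<close> confines \<open>x\<close> to a coset of the centralizer of \<open>m\<close>, and an
  FC-monomial containing \<open>x\<close> confines \<open>x\<close> to a coset of the FC-centre.\<close>

lemma eliminate_first:
  assumes inf: "\<not> finite_index G FC_centre"
    and xs: "distinct xs" "set xs \<subseteq> carrier G"
    and IH: "\<And>x. x \<in> carrier G \<Longrightarrow> x \<notin> set xs \<Longrightarrow> reorderable (x # xs) \<or> has_FC_monomial (x # xs)"
  shows "reorderable xs \<or> has_FC_monomial xs"
proof (rule ccontr)
  assume "\<not> ?thesis"
  then have nr: "\<not> reorderable xs" and nm: "\<not> has_FC_monomial xs" by auto
  note FCn = normal_FC_centre[unfolded normal_inv_iff]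
  have FCs: "subgroup FC_centre G" using FCn by blast
  define L where "L = {ys. distinct ys \<and> set ys \<subseteq> set xs}"
  have "L \<subseteq> {ys. set ys \<subseteq> set xs \<and> length ys \<le> length xs}"
    unfolding L_def using xs(1) by (auto) (metis List.finite_set card_mono distinct_card)
  then have finL: "finite L" using finite_lists_length_le[of "set xs"] finite_subset by blast
  have LG: "list_prod ys \<in> carrier G" if "ys \<in> L" for ys using that xs unfolding L_def by auto
  \<comment> \<open>For given \<open>as\<close> and \<open>bs\<close>, all solutions
    \<open>x\<close> lie in one coset of the centralizer of \<open>list_prod as\<close>;
    \<open>sol\<close> picks its representative.\<close>
  define sol where "sol as bs = (SOME x. x \<in> carrier G \<and> x \<otimes> list_prod xs =
      list_prod as \<otimes> x \<otimes> list_prod bs)" for as bs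
  define F where "F = carrier G \<inter> (set xs \<union> (\<lambda>(as, bs). sol as bs) ` (L \<times> L)
      \<union> (\<lambda>(as, bs). inv (list_prod as) \<otimes> inv (list_prod bs)) ` (L \<times> L))"
  \<comment> \<open>The empty word is left out: its centralizer is the whole group, so finite index
    would carry no information.\<close>
  define \<H> where "\<H> = insert FC_centre ((\<lambda>as. centralizer (list_prod as)) ` (L - {[]}))"
  have "finite F" "F \<subseteq> carrier G" "finite \<H>" using finL by (auto simp: F_def \<H>_def)
  moreover have "subgroup H G" if "H \<in> \<H>" for H
    using that FCs subgroup_centralizer LG by (auto simp: \<H>_def)
  moreover have "carrier G \<subseteq> (\<Union>H\<in>\<H>. \<Union>f\<in>F. H #> f)"
  proof
    fix x assume x: "x \<in> carrier G"
    show "x \<in> (\<Union>H\<in>\<H>. \<Union>f\<in>F. H #> f)"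
    proof (cases "x \<in> set xs")
      case True
      then have "x \<in> F" using x by (simp add: F_def)
      moreover have "x \<in> FC_centre #> x" by (rule rcos_self[OF x FCs])
      ultimately show ?thesis by (auto simp: \<H>_def)
    next
      case xn: False
      have split: "\<exists>as bs. ys = as @ x # bs \<and> as \<in> L \<and> bs \<in> L \<and> x \<notin> set as \<and> x \<notin> set bs"
        if ys: "distinct ys" "set ys \<subseteq> set (x # xs)" "x \<in> set ys" for ys
      proof -
        obtain as bs where "ys = as @ x # bs" using ys(3) by (meson split_list)
        then show ?thesis using ys unfolding L_def by (intro exI[of _ as] exI[of _ bs]) auto
      qed
      consider "reorderable (x # xs)" | "has_FC_monomial (x # xs)" using IH[OF x xn] by blast
      then show ?thesis
      proof cases
        case 1
        then obtain zs where zs: "distinct zs" "set zs = set (x # xs)" "zs \<noteq> x # xs"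
            "list_prod zs = list_prod (x # xs)" by (auto simp: reorderable_def)
        obtain as bs where ab: "zs = as @ x # bs" "as \<in> L" "bs \<in> L" "x \<notin> set as" "x \<notin> set bs"
          using split[OF zs(1)] zs(2) by auto
        have G: "set as \<subseteq> carrier G" "set bs \<subseteq> carrier G" using ab xs by (auto simp: L_def)
        have eq: "x \<otimes> list_prod xs = list_prod as \<otimes> x \<otimes> list_prod bs"
          using zs(4) ab G x by (simp add: list_prod_append m_assoc)
        show ?thesis
        proof (cases "as = []")
          \<comment> \<open>Here \<open>x\<close> stays in front. Cancelling it leaves a nontrivial
            reordering of \<open>xs\<close>, contradicting \<open>nr\<close>.\<close>
          case True
          then have "list_prod bs = list_prod xs" using eq G x xs by (simp add: m_assoc)
          moreover have "set bs = set xs" using zs(2) ab True xn by auto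
          moreover have "distinct bs" "bs \<noteq> xs" using ab zs True by auto
          ultimately show ?thesis using nr unfolding reorderable_def by blast
        next
          case False
          define y where "y = sol as bs"
          have y: "y \<in> carrier G" "y \<otimes> list_prod xs = list_prod as \<otimes> y \<otimes> list_prod bs"
            unfolding y_def sol_def
              using someI[of "\<lambda>x. x \<in> carrier G \<and> x \<otimes> list_prod xs = list_prod as \<otimes> x \<otimes> list_prod bs" x] x eq by auto
          \<comment> \<open>Every solution \<open>u\<close> conjugates \<open>list_prod as\<close>
            to the same element, so two solutions differ by a factor in its centralizer.\<close>
          have *: "inv u \<otimes> list_prod as \<otimes> u = list_prod xs \<otimes> inv (list_prod bs)"
            if "u \<in> carrier G" "u \<otimes> list_prod xs = list_prod as \<otimes> u \<otimes> list_prod bs" for u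
          proof -
            have "list_prod xs = inv u \<otimes> (list_prod as \<otimes> u \<otimes> list_prod bs)"
              using that G xs by (metis inv_solve_left list_prod_closed m_closed)
            then show ?thesis using that G by (simp add: m_assoc)
          qed
          have "x \<otimes> inv y \<in> centralizer (list_prod as)"
            using conj_eq_iff[of "list_prod as" x y] *[OF x eq] *[OF y] G x y by auto
          then have "x \<in> centralizer (list_prod as) #> y"
            using subgroup.rcos_module_rev[OF subgroup_centralizer is_group y(1) x] G by auto
          moreover have "y \<in> F" using y ab by (force simp: F_def y_def)
          ultimately show ?thesis using False ab by (auto simp: \<H>_def)
        qed
      next
        case 2
        then obtain ys where ys: "distinct ys" "ys \<noteq> []" "set ys \<subseteq> set (x # xs)" "list_prod ys \<in> FC_centre"
          by (auto simp: has_FC_monomial_def)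
        have "x \<in> set ys" using nm ys unfolding has_FC_monomial_def by auto
        then obtain as bs where ab: "ys = as @ x # bs" "as \<in> L" "bs \<in> L" using split[OF ys(1,3)] by blast
        define p q where "p = list_prod as" and "q = list_prod bs"
        have pq: "p \<in> carrier G" "q \<in> carrier G" using LG ab by (auto simp: p_def q_def)
        have "set as \<subseteq> carrier G" "set bs \<subseteq> carrier G" using ab xs by (auto simp: L_def)
        then have "p \<otimes> x \<otimes> q \<in> FC_centre" using ys(4) ab pq x
          by (simp add: list_prod_append m_assoc p_def q_def)
        \<comment> \<open>Conjugation, which preserves the FC-centre, moves \<open>p\<close> to the
          end and leaves \<open>x\<close> in front, so \<open>x\<close> is confined to one
          coset.\<close>
        then have "inv p \<otimes> (p \<otimes> x \<otimes> q) \<otimes> inv (inv p) \<in> FC_centre"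
          using FCn pq by (meson inv_closed)
        also have "inv p \<otimes> (p \<otimes> x \<otimes> q) \<otimes> inv (inv p) = x \<otimes> q \<otimes> p"
          using pq x by (simp add: m_assoc[symmetric])
        also have "\<dots> = x \<otimes> inv (inv p \<otimes> inv q)" using pq x by (simp add: inv_mult_group m_assoc)
        finally have "x \<in> FC_centre #> (inv p \<otimes> inv q)"
          using subgroup.rcos_module_rev[OF FCs is_group _ x] pq by auto
        moreover have "inv p \<otimes> inv q \<in> F" using ab pq by (force simp: F_def p_def q_def)
        ultimately show ?thesis by (auto simp: \<H>_def)
      qed
    qed
  qed
  \<comment> \<open>By \<open>inf\<close> the member of finite index is not the FC-centre. It is the
    centralizer of a nonempty monomial in \<open>xs\<close>, which therefore lies in the FC-centre,
    contradicting \<open>nm\<close>.\<close>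
  ultimately obtain H where H: "H \<in> \<H>" "finite_index G H" using coset_cover by metis
  then obtain as where as: "as \<in> L" "as \<noteq> []" "finite_index G (centralizer (list_prod as))"
    using inf by (auto simp: \<H>_def)
  then have "list_prod as \<in> FC_centre" using finite_index_centralizer_iff LG by blast
  then show False using as nm unfolding has_FC_monomial_def L_def by blast
qed

text \<open>Eliminating all \<open>n\<close> entries one by one ends with the empty list, which is
  neither reorderable nor has a nonempty monomial. In the induction \<open>k\<close> counts the
  eliminated entries.\<close>

lemma finite_index_FC_centre_if_reorderable:
  assumes "\<And>xs. distinct xs \<Longrightarrow> set xs \<subseteq> carrier G \<Longrightarrow> length xs = n \<Longrightarrow> reorderable xs"
  shows "finite_index G FC_centre"
proof (rule ccontr)
  assume inf: "\<not> finite_index G FC_centre"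
  have "reorderable xs \<or> has_FC_monomial xs"
    if "distinct xs" "set xs \<subseteq> carrier G" "length xs + k = n" for xs k
    using that
  proof (induction k arbitrary: xs)
    case 0
    then show ?case using assms by simp
  next
    case (Suc k)
    show ?case
      by (rule eliminate_first[OF inf]) (use Suc in auto)
  qed
  from this[of "[]" n] have "reorderable [] \<or> has_FC_monomial []" by simp
  then show False by (auto simp: reorderable_def has_FC_monomial_def)
qed

text \<open>Schreier's method gives a finite set \<open>D\<close> in the FC-centre generating a
  subgroup \<open>K\<close> of finite index in \<open>G\<close>. The abelian subgroup is the centre
  of \<open>K\<close>: the elements of \<open>K\<close> commuting with all of
  \<open>D\<close>.\<close>

lemma virtually_abelian_if_finite_index_FC_centre:
  assumes fg: "finitely_generated G" and fi: "finite_index G FC_centre"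
  shows "virtually_abelian G"
proof -
  obtain S where S: "finite S" "S \<subseteq> carrier G" "generate G S = carrier G"
    using fg by (auto simp: finitely_generated_def)
  have FCs: "subgroup FC_centre G" using fi by (simp add: finite_index_def)
  define S' where "S' = S \<union> m_inv G ` S"
  have S': "finite S'" "S' \<subseteq> carrier G" using S by (auto simp: S'_def)
  define r where "r C = (SOME x. x \<in> C)" for C :: "'a set"
  have r: "r (FC_centre #> x) \<in> carrier G" "x \<otimes> inv (r (FC_centre #> x)) \<in> FC_centre"
    if x: "x \<in> carrier G" for x
  proof -
    have rx: "r (FC_centre #> x) \<in> FC_centre #> x"
      unfolding r_def using rcos_self[OF x FCs] by (rule someI)
    then show G: "r (FC_centre #> x) \<in> carrier G"
      using rx x FCs by (meson r_coset_subset_G subgroup.subset subsetD)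
    have "FC_centre #> x = FC_centre #> r (FC_centre #> x)"
      by (rule repr_independence[OF rx x FCs])
    then show "x \<otimes> inv (r (FC_centre #> x)) \<in> FC_centre" using rcos_eq_iff[OF FCs x G] by simp
  qed
  \<comment> \<open>Adjoining \<open>\<one>\<close> puts \<open>\<one>\<close> into
    \<open>K <#> T\<close>, where the induction over words starts.\<close>
  define T where "T = insert \<one> (r ` (rcosets FC_centre))"
  have T: "finite T" "T \<subseteq> carrier G" using fi r by (auto simp: T_def finite_index_def rcosets_image)
  \<comment> \<open>The Schreier elements: \<open>t \<otimes> s\<close> is
    \<open>\<delta> t s\<close> times the representative of its coset, so \<open>K <#> T\<close>
    absorbs \<open>s\<close> on the right.\<close>
  define \<delta> where "\<delta> t s = t \<otimes> s \<otimes> inv (r (FC_centre #> (t \<otimes> s)))" for t s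
  define D where "D = (\<lambda>(t, s). \<delta> t s) ` (T \<times> S')"
  have D: "finite D" "D \<subseteq> FC_centre" using T S' r by (auto simp: D_def \<delta>_def intro!: r)
  have DG: "D \<subseteq> carrier G" using D FCs subgroup.subset by blast
  define K where "K = generate G D"
  have Ks: "subgroup K G" unfolding K_def by (rule generate_is_subgroup[OF DG])
  have KG: "K \<subseteq> carrier G" using Ks by (rule subgroup.subset)
  have step: "x \<otimes> s \<in> K <#> T" if x: "x \<in> K <#> T" and s: "s \<in> S'" for x s
  proof -
    obtain k t where kt: "k \<in> K" "t \<in> T" "x = k \<otimes> t" using x by (auto simp: set_mult_def)
    have G: "k \<in> carrier G" "t \<in> carrier G" "s \<in> carrier G" using kt KG T S' s by auto
    define u where "u = r (FC_centre #> (t \<otimes> s))"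
    have u: "u \<in> T" "u \<in> carrier G" using G r by (auto simp: u_def T_def rcosets_image)
    have "\<delta> t s \<in> K" unfolding K_def using kt s by (intro generate.incl) (auto simp: D_def)
    then have "k \<otimes> \<delta> t s \<in> K" using kt Ks by (simp add: subgroup.m_closed)
    moreover have "x \<otimes> s = (k \<otimes> \<delta> t s) \<otimes> u"
      using G u kt by (simp add: \<delta>_def u_def[symmetric] m_assoc)
    ultimately show ?thesis using u by (auto simp: set_mult_def)
  qed
  have closed: "y \<otimes> x \<in> K <#> T" if "x \<in> generate G S" "y \<in> K <#> T" for x y
    using that
  proof (induction arbitrary: y rule: generate.induct)
    case one
    have "y \<in> carrier G" using one KG T by (auto simp: set_mult_def)
    then show ?case using one by simp
  next
    case (incl h)
    then show ?case using step by (auto simp: S'_def)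
  next
    case (inv h)
    then show ?case using step by (auto simp: S'_def)
  next
    case (eng h1 h2)
    then have "y \<in> carrier G" "h1 \<in> carrier G" "h2 \<in> carrier G"
      using KG T S by (auto simp: set_mult_def)
    then show ?case using eng by (simp add: m_assoc[symmetric])
  qed
  have "\<one> \<otimes> \<one> \<in> K <#> T"
    using subgroup.one_closed[OF Ks] unfolding set_mult_def T_def by blast
  then have KT: "carrier G \<subseteq> K <#> T" using closed[of _ \<one>] S by force
  have "finite_index G K"
  proof -
    have "rcosets K \<subseteq> (\<lambda>t. K #> t) ` T"
    proof
      fix C assume "C \<in> rcosets K"
      then obtain x where x: "x \<in> carrier G" "C = K #> x" by (auto simp: rcosets_image)
      then obtain k t where kt: "k \<in> K" "t \<in> T" "x = k \<otimes> t" using KT by (auto simp: set_mult_def)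
      then have "x \<in> K #> t" by (auto simp: r_coset_def)
      then have "C = K #> t" using repr_independence[OF _ _ Ks] x kt T by (metis subsetD)
      then show "C \<in> (\<lambda>t. K #> t) ` T" using kt by blast
    qed
    then show ?thesis using T Ks finite_subset unfolding finite_index_def by blast
  qed
  moreover have "finite_index G (carrier G \<inter> (\<Inter>d\<in>D. centralizer d))"
    using D DG finite_index_centralizer_iff by (intro finite_index_INT) blast+
  ultimately have A: "finite_index G (K \<inter> (carrier G \<inter> (\<Inter>d\<in>D. centralizer d)))" (is "finite_index G ?A")
    by (rule finite_index_Int)
  then have As: "subgroup ?A G" by (simp add: finite_index_def)
  \<comment> \<open>\<open>D\<close> lies in the centralizer of \<open>a\<close>, which is a
    subgroup and hence contains all of \<open>K\<close>.\<close>
  have comm: "a \<otimes> k = k \<otimes> a" if a: "a \<in> ?A" and k: "k \<in> K" for a k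
  proof -
    have aG: "a \<in> carrier G" using a by blast
    have "D \<subseteq> centralizer a" using a DG by (force simp: centralizer_def)
    then have "K \<subseteq> centralizer a" unfolding K_def
      by (rule generate_subgroup_incl[OF _ subgroup_centralizer[OF aG]])
    then show ?thesis using k by (auto simp: centralizer_def)
  qed
  have "comm_group (G\<lparr>carrier := ?A\<rparr>)"
  proof (rule group.group_comm_groupI)
    show "Group.group (G\<lparr>carrier := ?A\<rparr>)" by (rule subgroup.subgroup_is_group[OF As is_group])
    show "x \<otimes>\<^bsub>G\<lparr>carrier := ?A\<rparr>\<^esub> y = y \<otimes>\<^bsub>G\<lparr>carrier := ?A\<rparr>\<^esub> x"
      if "x \<in> carrier (G\<lparr>carrier := ?A\<rparr>)" "y \<in> carrier (G\<lparr>carrier := ?A\<rparr>)" for x y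
      using that comm by simp
  qed
  then show ?thesis using A unfolding virtually_abelian_def by blast
qed

end

section \<open>Linear representations on spaces of functions\<close>

text \<open>All representation spaces are subspaces of a type
  \<open>'i \<Rightarrow> complex\<close>, so one interpretation of \<open>vector_space\<close>
  supplies bases and dimensions for all of them.\<close>

definition fscale :: "complex \<Rightarrow> ('i \<Rightarrow> complex) \<Rightarrow> 'i \<Rightarrow> complex" (infixr "*f" 75) where
  "c *f f = (\<lambda>i. c * f i)"

interpretation fn: Vector_Spaces.vector_space fscale
  by unfold_locales (auto simp: fscale_def plus_fun_def algebra_simps fun_eq_iff)

lemma fscale_apply [simp]: "(c *f f) i = c * f i"
  by (simp add: fscale_def)

lemma sum_fun_apply: "(\<Sum>a\<in>A. f a) x = (\<Sum>a\<in>A. f a x)"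
  by (induction A rule: infinite_finite_induct) auto

definition supp_space :: "'i set \<Rightarrow> ('i \<Rightarrow> complex) set" where
  "supp_space I = {f. \<forall>i. i \<notin> I \<longrightarrow> f i = 0}"

definition delta :: "'i \<Rightarrow> 'i \<Rightarrow> complex" where
  "delta i = (\<lambda>j. if j = i then 1 else 0)"

lemma subspace_supp_space: "fn.subspace (supp_space I)"
  by (rule fn.subspaceI) (auto simp: supp_space_def)

lemma supp_space_expand:
  assumes "finite I" "f \<in> supp_space I"
  shows "f = (\<Sum>i\<in>I. f i *f delta i)"
proof
  fix j show "f j = (\<Sum>i\<in>I. f i *f delta i) j"
    using assms
      by (cases "j \<in> I") (auto simp: sum_fun_apply delta_def supp_space_def if_distrib cong: if_cong)
qed

lemma supp_space_span:
  assumes "finite I"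
  shows "supp_space I \<subseteq> fn.span (delta ` I)"
proof
  fix f assume f: "f \<in> supp_space I"
  have "(\<Sum>i\<in>I. f i *f delta i) \<in> fn.span (delta ` I)"
    by (intro fn.span_sum fn.span_scale fn.span_base imageI)
  then show "f \<in> fn.span (delta ` I)" using supp_space_expand[OF assms f] by simp
qed

text \<open>The functions \<open>delta i\<close> with \<open>i \<in> I\<close> are independent. This
  is how a spanning set becomes a bound on a degree.\<close>

lemma card_spanning_supp_space:
  assumes I: "finite I" and T: "finite T" "supp_space I \<subseteq> fn.span T"
  shows "card I \<le> card T"
proof -
  have inj: "inj delta" by (rule injI) (metis delta_def zero_neq_one)
  have "fn.independent (delta ` I)"
  proof (rule fn.independent_if_scalars_zero)
    show "finite (delta ` I)" using I by simp
    fix f x assume s: "(\<Sum>x\<in>delta ` I. f x *f x) = 0" and x: "x \<in> delta ` I"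
    then obtain i where i: "i \<in> I" "x = delta i" by auto
    have "0 = (\<Sum>j\<in>I. f (delta j) *f delta j) i"
      using s sum.reindex[OF inj_on_subset[OF inj subset_UNIV], of "\<lambda>x. f x *f x" I] by simp
    also have "\<dots> = f (delta i)"
      using i I by (simp add: sum_fun_apply delta_def if_distrib cong: if_cong)
    finally show "f x = 0" using i by simp
  qed
  moreover have "delta ` I \<subseteq> fn.span T" using T by (auto simp: supp_space_def delta_def)
  ultimately have "card (delta ` I) \<le> card T" using fn.independent_span_bound[OF T(1)] by blast
  then show ?thesis using card_image[OF inj_on_subset[OF inj subset_UNIV]] by metis
qed

lemma dim_strict_mono:
  assumes U: "fn.subspace U" and W: "fn.subspace W" "U \<subset> W" and T: "finite T" "W \<subseteq> fn.span T"
  shows "fn.dim U < fn.dim W"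
proof -
  obtain B where B: "B \<subseteq> U" "fn.independent B" "U \<subseteq> fn.span B" "card B = fn.dim U"
    by (rule fn.basis_exists)
  obtain C where C: "C \<subseteq> W" "fn.independent C" "W \<subseteq> fn.span C" "card C = fn.dim W"
    by (rule fn.basis_exists)
  have finC: "finite C" using fn.independent_span_bound[OF T(1) C(2)] C T by blast
  obtain w where w: "w \<in> W" "w \<notin> U" using W by blast
  have "fn.span B = U" using B U by (metis fn.span_minimal subset_antisym)
  then have "fn.independent (insert w B)" using B w by (simp add: fn.independent_insertI)
  moreover have "insert w B \<subseteq> fn.span C" using w B W C by blast
  ultimately have "finite (insert w B) \<and> card (insert w B) \<le> card C"
    by (rule fn.independent_span_bound[OF finC])
  moreover have "w \<notin> B" using w B by blast
  ultimately show ?thesis using B C by auto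
qed

section \<open>Invariant subspaces and irreducibility\<close>

definition invariant ::
    "('a, 'b) monoid_scheme \<Rightarrow> ('a \<Rightarrow> ('i \<Rightarrow> complex) \<Rightarrow> 'i \<Rightarrow> complex) \<Rightarrow> ('i \<Rightarrow> complex) set \<Rightarrow> bool"
  where
  "invariant G \<pi> U \<longleftrightarrow> fn.subspace U \<and> (\<forall>g\<in>carrier G. \<forall>u\<in>U. \<pi> g u \<in> U)"

text \<open>Linearity is asked on the whole function type, the laws of an action only on
  \<open>W\<close>: the operators below also truncate to a fixed support, so \<open>\<one>\<close>
  acts as the identity on \<open>W\<close> only.\<close>

definition linear_rep ::
    "('a, 'b) monoid_scheme \<Rightarrow> ('a \<Rightarrow> ('i \<Rightarrow> complex) \<Rightarrow> 'i \<Rightarrow> complex) \<Rightarrow> ('i \<Rightarrow> complex) set \<Rightarrow> bool"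
  where
  "linear_rep G \<pi> W \<longleftrightarrow> invariant G \<pi> W \<and> (\<exists>T. finite T \<and> W \<subseteq> fn.span T) \<and>
     (\<forall>g\<in>carrier G. (\<forall>u v. \<pi> g (u + v) = \<pi> g u + \<pi> g v) \<and> (\<forall>c u. \<pi> g (c *f u) = c *f \<pi> g u)) \<and>
     (\<forall>w\<in>W. \<pi> \<one>\<^bsub>G\<^esub> w = w) \<and>
     (\<forall>g\<in>carrier G. \<forall>h\<in>carrier G. \<forall>w\<in>W. \<pi> (g \<otimes>\<^bsub>G\<^esub> h) w = \<pi> g (\<pi> h w))"

definition linear_irrep ::
    "('a, 'b) monoid_scheme \<Rightarrow> ('a \<Rightarrow> ('i \<Rightarrow> complex) \<Rightarrow> 'i \<Rightarrow> complex) \<Rightarrow> ('i \<Rightarrow> complex) set \<Rightarrow> bool"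
  where
  "linear_irrep G \<pi> W \<longleftrightarrow> linear_rep G \<pi> W \<and> W \<noteq> {0} \<and>
     (\<forall>U. U \<subseteq> W \<and> invariant G \<pi> U \<longrightarrow> U = {0} \<or> U = W)"

lemma linear_rep_sub:
  assumes "linear_rep G \<pi> W" "U \<subseteq> W" "invariant G \<pi> U"
  shows "linear_rep G \<pi> U"
proof -
  obtain T where "finite T" "W \<subseteq> fn.span T" using assms(1) by (auto simp: linear_rep_def)
  then have "\<exists>T. finite T \<and> U \<subseteq> fn.span T" using assms(2) by (intro exI[of _ T]) auto
  then show ?thesis using assms unfolding linear_rep_def by (simp add: subset_iff)
qed

lemma linear_rep_sum:
  assumes "linear_rep G \<pi> W" "g \<in> carrier G"
  shows "\<pi> g (\<Sum>i\<in>I. c i *f b i) = (\<Sum>i\<in>I. c i *f \<pi> g (b i))"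
proof -
  have a: "\<pi> g (u + v) = \<pi> g u + \<pi> g v" and s: "\<pi> g (d *f u) = d *f \<pi> g u" for u v d
    using assms unfolding linear_rep_def by blast+
  have "\<pi> g 0 = 0" using s[of 0 0] by simp
  then show ?thesis by (induction I rule: infinite_finite_induct) (simp_all add: a s)
qed

lemma invariant_span:
  assumes add: "\<And>g u v. g \<in> carrier G \<Longrightarrow> \<pi> g (u + v) = \<pi> g u + \<pi> g v"
    and scale: "\<And>g c u. g \<in> carrier G \<Longrightarrow> \<pi> g (c *f u) = c *f \<pi> g u"
    and S: "\<And>g s. g \<in> carrier G \<Longrightarrow> s \<in> S \<Longrightarrow> \<pi> g s \<in> fn.span S"
  shows "invariant G \<pi> (fn.span S)"
  unfolding invariant_def
proof (intro conjI ballI)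
  fix g u assume g: "g \<in> carrier G" and "u \<in> fn.span S"
  have "\<pi> g 0 = 0" using scale[OF g, of 0 0] by simp
  then show "\<pi> g u \<in> fn.span S"
    by (intro fn.span_induct_alt[OF \<open>u \<in> fn.span S\<close>, of "\<lambda>u. \<pi> g u \<in> fn.span S"])
      (auto simp: add[OF g] scale[OF g] S[OF g] intro!: fn.span_add fn.span_scale fn.span_zero)
qed simp

text \<open>A nonzero invariant subspace of least dimension is irreducible, since a proper subspace
  has strictly smaller dimension.\<close>

lemma exists_irreducible_sub:
  assumes W: "linear_rep G \<pi> W" "W \<noteq> {0}"
  shows "\<exists>U\<subseteq>W. linear_irrep G \<pi> U"
proof -
  define P where "P U \<longleftrightarrow> U \<subseteq> W \<and> invariant G \<pi> U \<and> U \<noteq> {0}" for U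
  have "P W" using W by (simp add: P_def linear_rep_def)
  then obtain U where U: "P U" "\<And>V. P V \<Longrightarrow> fn.dim U \<le> fn.dim V"
    using ex_has_least_nat[of P W fn.dim] by blast
  obtain T where T: "finite T" "W \<subseteq> fn.span T" using W by (auto simp: linear_rep_def)
  have "V = {0} \<or> V = U" if V: "V \<subseteq> U" "invariant G \<pi> V" for V
  proof (rule ccontr)
    assume n: "\<not> ?thesis"
    then have "P V" using V U by (auto simp: P_def)
    moreover have "fn.dim V < fn.dim U"
      by (rule dim_strict_mono[of _ _ T]) (use n V U T in \<open>auto simp: P_def invariant_def\<close>)
    ultimately show False using U(2) by fastforce
  qed
  then have "linear_irrep G \<pi> U" using U(1) linear_rep_sub[OF W(1)] by (auto simp: P_def linear_irrep_def)
  then show ?thesis using U(1) by (auto simp: P_def)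
qed

section \<open>Passing between matrix representations and spaces of functions\<close>

lemma subspace_vec_iff:
  "VectorSpace.subspace class_ring U (module_vec TYPE(complex) n) \<longleftrightarrow>
     U \<subseteq> carrier_vec n \<and> 0\<^sub>v n \<in> U \<and> (\<forall>u\<in>U. \<forall>v\<in>U. u + v \<in> U) \<and> (\<forall>c. \<forall>u\<in>U. c \<cdot>\<^sub>v u \<in> U)"
proof -
  interpret vec_space "TYPE(complex)" n .
  show ?thesis
    unfolding VectorSpace.subspace_def LinearCombinations.submodule_def
    using vec_vs vec_module by (auto simp: module_vec_simps class_ring_simps)
qed

lemma mat_eq_if_mult_vec_eq:
  fixes A B :: "complex mat"
  assumes A: "A \<in> carrier_mat n n" and B: "B \<in> carrier_mat n n"
    and eq: "\<And>v. v \<in> carrier_vec n \<Longrightarrow> A *\<^sub>v v = B *\<^sub>v v"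
  shows "A = B"
proof (rule eq_matI)
  fix i j assume "i < dim_row B" "j < dim_col B"
  then have ij: "i < n" "j < n" using B by auto
  have "(A *\<^sub>v unit_vec n j) $ i = (B *\<^sub>v unit_vec n j) $ i" using eq[of "unit_vec n j"] by simp
  then show "A $$ (i, j) = B $$ (i, j)" using A B ij by simp
qed (use A B in auto)

lemma mult_mat_vec_index:
  assumes "A \<in> carrier_mat n m" "v \<in> carrier_vec m" "i < n"
  shows "(A *\<^sub>v v) $ i = (\<Sum>j<m. A $$ (i, j) * v $ j)"
  using assms by (auto simp: scalar_prod_def lessThan_atLeast0 intro!: sum.cong)

lemma mat_mult_index:
  assumes "A \<in> carrier_mat n m" "B \<in> carrier_mat m p" "i < n" "j < p"
  shows "(A * B) $$ (i, j) = (\<Sum>l<m. A $$ (i, l) * B $$ (l, j))"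
  using assms by (auto simp: scalar_prod_def lessThan_atLeast0 intro!: sum.cong)

lemma hom_GL_I:
  assumes G: "Group.group G" and car: "\<And>g. g \<in> carrier G \<Longrightarrow> \<sigma> g \<in> carrier_mat n n"
    and one: "\<sigma> \<one>\<^bsub>G\<^esub> = 1\<^sub>m n"
    and mult: "\<And>g h. g \<in> carrier G \<Longrightarrow> h \<in> carrier G \<Longrightarrow> \<sigma> (g \<otimes>\<^bsub>G\<^esub> h) = \<sigma> g * \<sigma> h"
  shows "\<sigma> \<in> hom G (GL n)"
proof -
  interpret Group.group G by (rule G)
  have "invertible_mat (\<sigma> g)" if g: "g \<in> carrier G" for g
  proof -
    have "\<sigma> g * \<sigma> (inv\<^bsub>G\<^esub> g) = 1\<^sub>m n" "\<sigma> (inv\<^bsub>G\<^esub> g) * \<sigma> g = 1\<^sub>m n"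
      using g mult[symmetric] one by simp_all
    then show ?thesis using car[OF g] car[of "inv\<^bsub>G\<^esub> g"] g
      unfolding invertible_mat_def inverts_mat_def by (intro conjI exI[of _ "\<sigma> (inv\<^bsub>G\<^esub> g)"]) auto
  qed
  then show ?thesis using car mult by (auto simp: hom_def carrier_GL)
qed

lemma hom_GL_D:
  assumes G: "Group.group G" and \<sigma>: "\<sigma> \<in> hom G (GL n)"
  shows "\<And>g. g \<in> carrier G \<Longrightarrow> \<sigma> g \<in> carrier_mat n n"
    and "\<sigma> \<one>\<^bsub>G\<^esub> = 1\<^sub>m n"
    and "\<And>g h. g \<in> carrier G \<Longrightarrow> h \<in> carrier G \<Longrightarrow> \<sigma> (g \<otimes>\<^bsub>G\<^esub> h) = \<sigma> g * \<sigma> h"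
proof -
  show "\<sigma> g \<in> carrier_mat n n" if "g \<in> carrier G" for g
    using hom_in_carrier[OF \<sigma> that] by (simp add: carrier_GL)
  show "\<sigma> \<one>\<^bsub>G\<^esub> = 1\<^sub>m n" using hom_one[OF \<sigma> G group_GL] by simp
  show "\<sigma> (g \<otimes>\<^bsub>G\<^esub> h) = \<sigma> g * \<sigma> h" if "g \<in> carrier G" "h \<in> carrier G" for g h
    using hom_mult[OF \<sigma> that] by simp
qed

text \<open>\<open>\<sigma>\<close> is the matrix form of \<open>\<pi>\<close> in a basis
  \<open>b\<close> of \<open>W\<close>. The clause on trivial action gives \<open>\<sigma>\<close> a
  kernel of finite index, \<open>b 0\<close> serves as a concrete nonzero vector, and the last
  clause bounds the degree from above.\<close>

lemma irrep_matrix_form: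
  fixes G (structure)
  assumes G: "Group.group G" and irr: "linear_irrep G \<pi> W"
  obtains k \<sigma> b where "irreducible_rep G k \<sigma>"
    and "\<forall>i<k. b i \<in> W" and "\<forall>w\<in>W. \<exists>c. w = (\<Sum>i<k. c i *f b i)"
    and "\<forall>g\<in>carrier G. \<forall>j<k. \<pi> g (b j) = (\<Sum>i<k. \<sigma> g $$ (i, j) *f b i)"
    and "\<forall>g\<in>carrier G. (\<forall>w\<in>W. \<pi> g w = w) \<longrightarrow> \<sigma> g = 1\<^sub>m k"
    and "b 0 \<noteq> 0" and "\<forall>T. finite T \<longrightarrow> W \<subseteq> fn.span T \<longrightarrow> k \<le> card T"
proof -
  interpret Group.group G by (rule G)
  have rep: "linear_rep G \<pi> W" and W0: "W \<noteq> {0}" using irr by (auto simp: linear_irrep_def)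
  have sW: "fn.subspace W" using rep by (simp add: linear_rep_def invariant_def)
  obtain T where T: "finite T" "W \<subseteq> fn.span T" using rep by (auto simp: linear_rep_def)
  obtain B where B: "B \<subseteq> W" "fn.independent B" "W \<subseteq> fn.span B"
    by (rule fn.basis_exists)
  have finB: "finite B" using fn.independent_span_bound[OF T(1) B(2)] B T by blast
  define k where "k = card B"
  obtain b where b: "bij_betw b {..<k} B"
    using ex_bij_betw_nat_finite[OF finB] unfolding k_def lessThan_atLeast0 by blast
  have binj: "inj_on b {..<k}" and bim: "b ` {..<k} = B" using b by (auto simp: bij_betw_def)
  have bW: "b i \<in> W" if "i < k" for i using that bim B by blast
  \<comment> \<open>The coordinate isomorphism from \<open>carrier_vec k\<close> onto
    \<open>W\<close>; \<open>\<psi>\<close> below is its inverse.\<close>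
  define \<phi> where "\<phi> v = (\<Sum>i<k. v $ i *f b i)" for v :: "complex vec"
  have surj: "\<exists>v\<in>carrier_vec k. w = \<phi> v" if "w \<in> W" for w
  proof -
    have "w \<in> fn.span B" using that B by blast
    then obtain u where "w = (\<Sum>x\<in>B. u x *f x)" using fn.span_finite[OF finB] by auto
    also have "\<dots> = (\<Sum>i<k. u (b i) *f b i)" using sum.reindex[OF binj] bim by (simp add: o_def)
    also have "\<dots> = \<phi> (vec k (\<lambda>i. u (b i)))" unfolding \<phi>_def by (intro sum.cong) auto
    finally show ?thesis by (intro bexI[of _ "vec k (\<lambda>i. u (b i))"]) auto
  qed
  have \<phi>W: "\<phi> v \<in> W" for v
    unfolding \<phi>_def using bW sW by (auto intro!: fn.subspace_sum fn.subspace_scale)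
  have \<phi>add: "\<phi> (u + v) = \<phi> u + \<phi> v" if "u \<in> carrier_vec k" "v \<in> carrier_vec k" for u v
    using that by (simp add: \<phi>_def fn.scale_left_distrib sum.distrib)
  have \<phi>smult: "\<phi> (c \<cdot>\<^sub>v v) = c *f \<phi> v" if "v \<in> carrier_vec k" for c v
    using that by (simp add: \<phi>_def fn.scale_sum_right)
  have ker: "v = 0\<^sub>v k" if v: "v \<in> carrier_vec k" "\<phi> v = 0" for v
  proof
    show "dim_vec v = dim_vec (0\<^sub>v k)" using v by simp
    fix i assume "i < dim_vec (0\<^sub>v k)"
    then have i: "i < k" by simp
    define u where "u x = v $ (the_inv_into {..<k} b x)" for x
    have "(\<Sum>x\<in>B. u x *f x) = (\<Sum>i<k. u (b i) *f b i)" using sum.reindex[OF binj] bim by (simp add: o_def)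
    also have "\<dots> = \<phi> v" unfolding \<phi>_def u_def using binj by (intro sum.cong) (auto simp: the_inv_into_f_f)
    finally have "(\<Sum>x\<in>B. u x *f x) = 0" using v by simp
    then have "u (b i) = 0" using fn.independentD[OF B(2) finB subset_refl] bim i by blast
    then show "v $ i = 0\<^sub>v k $ i" using i binj by (simp add: u_def the_inv_into_f_f)
  qed
  have inj: "u = v" if "u \<in> carrier_vec k" "v \<in> carrier_vec k" "\<phi> u = \<phi> v" for u v
  proof -
    have "\<phi> (u + (-1) \<cdot>\<^sub>v v) = 0" using that by (simp add: \<phi>add \<phi>smult fscale_def fun_eq_iff)
    then have "u + (-1) \<cdot>\<^sub>v v = 0\<^sub>v k" using that by (intro ker) auto
    then have "(u + (-1) \<cdot>\<^sub>v v) $ i = 0" if "i < k" for i using that by simp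
    then show ?thesis using that by (intro eq_vecI) auto
  qed
  define \<psi> where "\<psi> w = (SOME v. v \<in> carrier_vec k \<and> w = \<phi> v)" for w
  have \<psi>: "\<psi> w \<in> carrier_vec k" "\<phi> (\<psi> w) = w" if "w \<in> W" for w
  proof -
    have "\<exists>v. v \<in> carrier_vec k \<and> w = \<phi> v" using surj[OF that] by blast
    from someI_ex[OF this] show "\<psi> w \<in> carrier_vec k" "\<phi> (\<psi> w) = w" unfolding \<psi>_def by auto
  qed
  define \<sigma> where "\<sigma> g = mat k k (\<lambda>(i, j). \<psi> (\<pi> g (b j)) $ i)" for g
  have \<sigma>car: "\<sigma> g \<in> carrier_mat k k" for g by (simp add: \<sigma>_def)
  have \<pi>W: "\<pi> g w \<in> W" if "g \<in> carrier G" "w \<in> W" for g w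
    using rep that by (auto simp: linear_rep_def invariant_def)
  have act_b: "\<pi> g (b j) = (\<Sum>i<k. \<sigma> g $$ (i, j) *f b i)" if "g \<in> carrier G" "j < k" for g j
    using \<psi>(2)[OF \<pi>W[OF that(1) bW[OF that(2)]]] that by (simp add: \<phi>_def \<sigma>_def)
  have act: "\<phi> (\<sigma> g *\<^sub>v v) = \<pi> g (\<phi> v)" if g: "g \<in> carrier G" and v: "v \<in> carrier_vec k" for g v
  proof -
    have "\<pi> g (\<phi> v) = (\<Sum>j<k. v $ j *f (\<Sum>i<k. \<sigma> g $$ (i, j) *f b i))"
      unfolding \<phi>_def linear_rep_sum[OF rep g] using act_b[OF g] by (intro sum.cong) auto
    also have "\<dots> = (\<Sum>j<k. \<Sum>i<k. (\<sigma> g $$ (i, j) * v $ j) *f b i)"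
      by (simp add: fn.scale_sum_right mult.commute)
    also have "\<dots> = (\<Sum>i<k. \<Sum>j<k. (\<sigma> g $$ (i, j) * v $ j) *f b i)" by (rule sum.swap)
    also have "\<dots> = (\<Sum>i<k. (\<Sum>j<k. \<sigma> g $$ (i, j) * v $ j) *f b i)"
      by (simp add: fn.scale_sum_left)
    also have "\<dots> = \<phi> (\<sigma> g *\<^sub>v v)"
      unfolding \<phi>_def using mult_mat_vec_index[OF \<sigma>car v] by (intro sum.cong) auto
    finally show ?thesis by simp
  qed
  have triv: "\<sigma> g = 1\<^sub>m k" if g: "g \<in> carrier G" and "\<And>w. w \<in> W \<Longrightarrow> \<pi> g w = w" for g
  proof (rule mat_eq_if_mult_vec_eq[OF \<sigma>car one_carrier_mat])
    fix v :: "complex vec" assume v: "v \<in> carrier_vec k"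
    then have "\<phi> (\<sigma> g *\<^sub>v v) = \<phi> v" using act[OF g v] that \<phi>W by simp
    then show "\<sigma> g *\<^sub>v v = 1\<^sub>m k *\<^sub>v v"
      using inj v mult_mat_vec_carrier[OF \<sigma>car v] by simp
  qed
  have hom: "\<sigma> \<in> hom G (GL k)"
  proof (rule hom_GL_I[OF G \<sigma>car])
    show "\<sigma> \<one> = 1\<^sub>m k" by (rule triv) (use rep in \<open>auto simp: linear_rep_def\<close>)
    fix g h assume gh: "g \<in> carrier G" "h \<in> carrier G"
    show "\<sigma> (g \<otimes> h) = \<sigma> g * \<sigma> h"
    proof (rule mat_eq_if_mult_vec_eq[OF \<sigma>car mult_carrier_mat[OF \<sigma>car \<sigma>car]])
      fix v :: "complex vec" assume v: "v \<in> carrier_vec k"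
      have hv: "\<sigma> h *\<^sub>v v \<in> carrier_vec k" by (rule mult_mat_vec_carrier[OF \<sigma>car v])
      have "\<phi> (\<sigma> (g \<otimes> h) *\<^sub>v v) = \<pi> g (\<pi> h (\<phi> v))"
        using act[OF _ v] gh rep \<phi>W by (auto simp: linear_rep_def)
      also have "\<dots> = \<phi> (\<sigma> g *\<^sub>v (\<sigma> h *\<^sub>v v))" using act gh v hv by simp
      finally have "\<sigma> (g \<otimes> h) *\<^sub>v v = \<sigma> g *\<^sub>v (\<sigma> h *\<^sub>v v)"
        using inj mult_mat_vec_carrier[OF \<sigma>car v] mult_mat_vec_carrier[OF \<sigma>car hv] by blast
      then show "\<sigma> (g \<otimes> h) *\<^sub>v v = \<sigma> g * \<sigma> h *\<^sub>v v"
        using assoc_mult_mat_vec[OF \<sigma>car \<sigma>car v] by simp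
    qed
  qed
  have k: "0 < k"
  proof (rule ccontr)
    assume "\<not> 0 < k"
    then have "W \<subseteq> {0}" using surj by (auto simp: \<phi>_def)
    then show False using W0 fn.subspace_0[OF sW] by blast
  qed
  have \<phi>0: "\<phi> (0\<^sub>v k) = 0" by (simp add: \<phi>_def)
  have "U = {0\<^sub>v k} \<or> U = carrier_vec k" if U: "invariant_subspace G k \<sigma> U" for U
  proof -
    have Us: "U \<subseteq> carrier_vec k" "0\<^sub>v k \<in> U" "\<And>u v. u \<in> U \<Longrightarrow> v \<in> U \<Longrightarrow> u + v \<in> U"
        "\<And>c u. u \<in> U \<Longrightarrow> c \<cdot>\<^sub>v u \<in> U" "\<And>g u. g \<in> carrier G \<Longrightarrow> u \<in> U \<Longrightarrow> \<sigma> g *\<^sub>v u \<in> U"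
      using U unfolding invariant_subspace_def subspace_vec_iff by auto
    \<comment> \<open>Irreducibility is transferred by mapping an invariant space of coordinate
      vectors into \<open>W\<close>.\<close>
    have "invariant G \<pi> (\<phi> ` U)"
      unfolding invariant_def
    proof (intro conjI ballI fn.subspaceI)
      show "0 \<in> \<phi> ` U" using \<phi>0 Us(2) by (metis imageI)
      fix x y assume "x \<in> \<phi> ` U" "y \<in> \<phi> ` U"
      then obtain u v where "u \<in> U" "v \<in> U" "x = \<phi> u" "y = \<phi> v" by blast
      then show "x + y \<in> \<phi> ` U" using \<phi>add[of u v] Us by (metis image_eqI subsetD)
    next
      fix c x assume "x \<in> \<phi> ` U"
      then obtain u where u: "u \<in> U" "x = \<phi> u" by blast
      then show "c *f x \<in> \<phi> ` U"
        using \<phi>smult[of u c] Us by (intro image_eqI[of _ _ "c \<cdot>\<^sub>v u"]) auto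
    next
      fix g x assume g: "g \<in> carrier G" and "x \<in> \<phi> ` U"
      then obtain u where u: "u \<in> U" "x = \<phi> u" by blast
      then show "\<pi> g x \<in> \<phi> ` U"
        using act[OF g, of u] Us g by (intro image_eqI[of _ _ "\<sigma> g *\<^sub>v u"]) auto
    qed
    moreover have "\<phi> ` U \<subseteq> W" using \<phi>W by blast
    ultimately consider "\<phi> ` U = {0}" | "\<phi> ` U = W" using irr unfolding linear_irrep_def by blast
    then show ?thesis
    proof cases
      case 1
      then have "U \<subseteq> {0\<^sub>v k}" using ker Us(1) by blast
      then show ?thesis using Us(2) by blast
    next
      case 2
      have "carrier_vec k \<subseteq> U"
      proof
        fix v :: "complex vec" assume v: "v \<in> carrier_vec k"
        then obtain u where "u \<in> U" "\<phi> v = \<phi> u" using 2 \<phi>W by blast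
        then show "v \<in> U" using inj v Us(1) by blast
      qed
      then show ?thesis using Us(1) by blast
    qed
  qed
  then have irr_\<sigma>: "irreducible_rep G k \<sigma>" using hom k by (auto simp: irreducible_rep_def)
  have span_b: "\<exists>c. w = (\<Sum>i<k. c i *f b i)" if "w \<in> W" for w
    using surj[OF that] by (auto simp: \<phi>_def)
  have b0: "b 0 \<noteq> 0" using fn.dependent_zero B(2) bim k by (metis imageI lessThan_iff)
  have k_le: "k \<le> card T" if "finite T" "W \<subseteq> fn.span T" for T
    using fn.independent_span_bound[OF that(1) B(2)] that(2) B(1) unfolding k_def by blast
  show thesis
    by (rule that[of k \<sigma> b, OF irr_\<sigma> _ _ _ _ b0]) (use bW span_b act_b triv k_le in auto)
qed

text \<open>The value 0 at indices \<open>i \<ge> n\<close> puts every image into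
  \<open>supp_space {..<n}\<close>, whatever \<open>f\<close> is. An identity matrix thus acts as
  truncation to \<open>{..<n}\<close>.\<close>

definition act :: "nat \<Rightarrow> ('a \<Rightarrow> complex mat) \<Rightarrow> 'a \<Rightarrow> (nat \<Rightarrow> complex) \<Rightarrow> nat \<Rightarrow> complex" where
  "act n \<sigma> g f = (\<lambda>i. if i < n then \<Sum>j<n. \<sigma> g $$ (i, j) * f j else 0)"

lemma act_add: "act n \<sigma> g (u + v) = act n \<sigma> g u + act n \<sigma> g v"
  by (auto simp: act_def fun_eq_iff algebra_simps sum.distrib)

lemma act_scale: "act n \<sigma> g (c *f u) = c *f act n \<sigma> g u"
  by (auto simp: act_def fun_eq_iff sum_distrib_left mult.left_commute)

lemma act_in_supp_space: "act n \<sigma> g f \<in> supp_space {..<n}"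
  by (auto simp: act_def supp_space_def)

lemma act_eq_self:
  assumes "\<sigma> g = 1\<^sub>m n" "f \<in> supp_space {..<n}"
  shows "act n \<sigma> g f = f"
proof
  fix i
  have "(\<Sum>j<n. 1\<^sub>m n $$ (i, j) * f j) = f i" if "i < n"
  proof -
    have "(\<Sum>j<n. 1\<^sub>m n $$ (i, j) * f j) = (\<Sum>j<n. if i = j then f j else 0)"
      using that by (intro sum.cong) auto
    then show ?thesis using that by simp
  qed
  then show "act n \<sigma> g f i = f i" using assms by (auto simp: act_def supp_space_def)
qed

lemma eq_one_if_act_trivial:
  assumes car: "\<sigma> g \<in> carrier_mat n n" and triv: "\<And>f. f \<in> supp_space {..<n} \<Longrightarrow> act n \<sigma> g f = f"
  shows "\<sigma> g = 1\<^sub>m n"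
proof (rule eq_matI)
  fix i j assume "i < dim_row (1\<^sub>m n :: complex mat)" "j < dim_col (1\<^sub>m n :: complex mat)"
  then have ij: "i < n" "j < n" by auto
  have "delta j \<in> supp_space {..<n}" using ij by (auto simp: supp_space_def delta_def)
  then have "act n \<sigma> g (delta j) i = delta j i" using triv by metis
  moreover have "act n \<sigma> g (delta j) i = \<sigma> g $$ (i, j)"
  proof -
    have "act n \<sigma> g (delta j) i = (\<Sum>l<n. \<sigma> g $$ (i, l) * delta j l)" using ij by (simp add: act_def)
    also have "\<dots> = (\<Sum>l<n. if l = j then \<sigma> g $$ (i, l) else 0)"
      by (rule sum.cong) (auto simp: delta_def)
    finally show ?thesis using ij by simp
  qed
  ultimately show "\<sigma> g $$ (i, j) = 1\<^sub>m n $$ (i, j)" using ij by (simp add: delta_def)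
qed (use car in auto)

lemma act_mult:
  assumes G: "Group.group G" and hom: "\<sigma> \<in> hom G (GL n)" and g: "g \<in> carrier G" and h: "h \<in> carrier G"
  shows "act n \<sigma> (g \<otimes>\<^bsub>G\<^esub> h) f = act n \<sigma> g (act n \<sigma> h f)"
proof
  note \<sigma> = hom_GL_D[OF G hom]
  fix i
  show "act n \<sigma> (g \<otimes>\<^bsub>G\<^esub> h) f i = act n \<sigma> g (act n \<sigma> h f) i"
  proof (cases "i < n")
    case True
    have "act n \<sigma> (g \<otimes>\<^bsub>G\<^esub> h) f i = (\<Sum>j<n. \<Sum>l<n. \<sigma> g $$ (i, l) * \<sigma> h $$ (l, j) * f j)"
      using True mat_mult_index[OF \<sigma>(1)[OF g] \<sigma>(1)[OF h] True]
      by (simp add: act_def \<sigma>(3)[OF g h] sum_distrib_right)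
    also have "\<dots> = (\<Sum>l<n. \<Sum>j<n. \<sigma> g $$ (i, l) * \<sigma> h $$ (l, j) * f j)" by (rule sum.swap)
    finally show ?thesis using True by (simp add: act_def sum_distrib_left mult.assoc)
  qed (simp add: act_def)
qed

text \<open>Converse passage to \<open>irrep_matrix_form\<close>: \<open>vec n\<close> identifies
  functions supported on \<open>{..<n}\<close> with vectors and carries \<open>act\<close> to
  multiplication by the matrix.\<close>

lemma linear_irrep_act:
  fixes G (structure)
  assumes G: "Group.group G" and irr: "irreducible_rep G n \<sigma>"
  shows "linear_irrep G (act n \<sigma>) (supp_space {..<n})"
proof -
  interpret Group.group G by (rule G)
  have hom: "\<sigma> \<in> hom G (GL n)" and n: "0 < n" using irr by (auto simp: irreducible_rep_def)
  note \<sigma> = hom_GL_D[OF G hom]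
  have vec_act: "vec n (act n \<sigma> g f) = \<sigma> g *\<^sub>v vec n f" if "g \<in> carrier G" for g f
    using mult_mat_vec_index[OF \<sigma>(1)[OF that], of "vec n f"]  \<sigma>(1)[OF that] 
    by (intro eq_vecI) (auto simp: act_def)
  have rep: "linear_rep G (act n \<sigma>) (supp_space {..<n})"
    unfolding linear_rep_def invariant_def
  proof (intro conjI ballI allI exI)
    show "finite (delta ` {..<n})" "supp_space {..<n} \<subseteq> fn.span (delta ` {..<n})"
      by (simp, rule supp_space_span) simp
    show "fn.subspace (supp_space {..<n})" by (rule subspace_supp_space)
    show "act n \<sigma> \<one> w = w" if "w \<in> supp_space {..<n}" for w
      by (rule act_eq_self[where \<sigma> = \<sigma> and g = \<one>, OF \<sigma>(2) that])
    show "act n \<sigma> (g \<otimes> h) w = act n \<sigma> g (act n \<sigma> h w)" if "g \<in> carrier G" "h \<in> carrier G" for g h w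
      by (rule act_mult[OF G hom that])
  qed (simp_all add: act_add act_scale act_in_supp_space)
  moreover have "supp_space {..<n} \<noteq> {0}"
  proof
    assume "supp_space {..<n} = {0}"
    moreover have "delta 0 \<in> supp_space {..<n}" using n by (auto simp: supp_space_def delta_def)
    ultimately have "delta (0::nat) = 0" by blast
    then have "delta (0::nat) 0 = 0" by simp
    then show False by (simp add: delta_def)
  qed
  moreover have "U = {0} \<or> U = supp_space {..<n}"
    if U: "U \<subseteq> supp_space {..<n}" "invariant G (act n \<sigma>) U" for U
  proof -
    have sU: "fn.subspace U" using U by (simp add: invariant_def)
    have "invariant_subspace G n \<sigma> (vec n ` U)"
      unfolding invariant_subspace_def subspace_vec_iff
    proof (intro conjI ballI allI)
      show "vec n ` U \<subseteq> carrier_vec n" by auto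
      show "0\<^sub>v n \<in> vec n ` U" using fn.subspace_0[OF sU] by (intro image_eqI[of _ _ 0]) auto
    next
      fix u v assume "u \<in> vec n ` U" "v \<in> vec n ` U"
      then obtain f h where "f \<in> U" "h \<in> U" "u = vec n f" "v = vec n h" by blast
      then show "u + v \<in> vec n ` U"
        using fn.subspace_add[OF sU] by (intro image_eqI[of _ _ "f + h"]) auto
    next
      fix c u assume "u \<in> vec n ` U"
      then obtain f where "f \<in> U" "u = vec n f" by blast
      then show "c \<cdot>\<^sub>v u \<in> vec n ` U"
        using fn.subspace_scale[OF sU] by (intro image_eqI[of _ _ "c *f f"]) auto
    next
      fix g u assume g: "g \<in> carrier G" and "u \<in> vec n ` U"
      then obtain f where "f \<in> U" "u = vec n f" by blast
      then show "\<sigma> g *\<^sub>v u \<in> vec n ` U" using U g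
        by (intro image_eqI[of _ _ "act n \<sigma> g f"]) (auto simp: vec_act invariant_def)
    qed
    then consider "vec n ` U = {0\<^sub>v n}" | "vec n ` U = carrier_vec n"
      using irr unfolding irreducible_rep_def by blast
    then show ?thesis
    proof cases
      case 1
      have "f = 0" if f: "f \<in> U" for f
      proof
        fix i
        have "vec n f = 0\<^sub>v n" using 1 f by blast
        then have "i < n \<Longrightarrow> f i = 0" by (metis index_vec index_zero_vec(1))
        then show "f i = 0 i" using f U by (auto simp: supp_space_def)
      qed
      then show ?thesis using fn.subspace_0[OF sU] by blast
    next
      case 2
      have "f \<in> U" if f: "f \<in> supp_space {..<n}" for f
      proof -
        obtain h where h: "h \<in> U" "vec n f = vec n h" using 2 by (metis imageE vec_carrier)
        have "f i = h i" for i
        proof (cases "i < n")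
          case True
          then show ?thesis using h by (metis index_vec)
        next
          case False
          then show ?thesis using h U f by (auto simp: supp_space_def)
        qed
        then show ?thesis using h by (metis ext)
      qed
      then show ?thesis using U by blast
    qed
  qed
  ultimately show ?thesis by (auto simp: linear_irrep_def)
qed

text \<open>Schur's lemma in equal degrees: the kernel of \<open>T\<close> is
  \<open>\<rho>\<close>-invariant and proper, hence zero, and a square matrix with zero kernel is
  invertible.\<close>

lemma rep_equivalence_if_intertwiner:
  assumes G: "Group.group G" and \<rho>: "\<rho> \<in> finite_irreps G n" and \<sigma>: "\<sigma> \<in> finite_irreps G n"
    and T: "T \<in> carrier_mat n n" "T \<noteq> 0\<^sub>m n n"
    and eq: "\<And>g. g \<in> carrier G \<Longrightarrow> T * \<rho> g = \<sigma> g * T"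
  shows "(\<rho>, \<sigma>) \<in> rep_equivalence G n"
proof -
  have irr: "irreducible_rep G n \<rho>" using \<rho> by (simp add: finite_irreps_def)
  have \<rho>c: "\<rho> g \<in> carrier_mat n n" and \<sigma>c: "\<sigma> g \<in> carrier_mat n n" if "g \<in> carrier G" for g
    using hom_GL_D(1)[OF G _ that] \<rho> \<sigma> by (auto simp: finite_irreps_def irreducible_rep_def)
  define K where "K = {v \<in> carrier_vec n. T *\<^sub>v v = 0\<^sub>v n}"
  have "invariant_subspace G n \<rho> K"
    unfolding invariant_subspace_def subspace_vec_iff
  proof (intro conjI ballI allI)
    show "K \<subseteq> carrier_vec n" "0\<^sub>v n \<in> K" using T by (auto simp: K_def)
    show "u + v \<in> K" if "u \<in> K" "v \<in> K" for u v
      using that T by (auto simp: K_def mult_add_distrib_mat_vec)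
    show "c \<cdot>\<^sub>v u \<in> K" if "u \<in> K" for c u
      using that T by (auto simp: K_def mult_mat_vec)
    show "\<rho> g *\<^sub>v u \<in> K" if g: "g \<in> carrier G" and u: "u \<in> K" for g u
    proof -
      have uc: "u \<in> carrier_vec n" "T *\<^sub>v u = 0\<^sub>v n" using u by (auto simp: K_def)
      have "T *\<^sub>v (\<rho> g *\<^sub>v u) = (T * \<rho> g) *\<^sub>v u" using T \<rho>c[OF g] uc by simp
      also have "\<dots> = \<sigma> g *\<^sub>v (T *\<^sub>v u)"
        using T \<sigma>c[OF g] uc(1) eq[OF g] assoc_mult_mat_vec by metis
      also have "\<dots> = 0\<^sub>v n" using uc \<sigma>c[OF g] by auto
      finally show ?thesis using \<rho>c[OF g] uc by (auto simp: K_def)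
    qed
  qed
  then consider "K = {0\<^sub>v n}" | "K = carrier_vec n" using irr by (auto simp: irreducible_rep_def)
  then have "K = {0\<^sub>v n}"
  proof cases
    case 2
    have "T = 0\<^sub>m n n"
    proof (rule mat_eq_if_mult_vec_eq[OF T(1)])
      fix v :: "complex vec" assume "v \<in> carrier_vec n"
      then have "v \<in> K" "v \<in> carrier_vec n" using 2 by auto
      then show "T *\<^sub>v v = 0\<^sub>m n n *\<^sub>v v" by (auto simp: K_def)
    qed simp
    then show ?thesis using T by simp
  qed
  then have "det T \<noteq> 0" using det_0_iff_vec_prod_zero[OF T(1)] by (auto simp: K_def)
  then have "T \<in> carrier (GL n)"
    using det_non_zero_imp_unit[OF T(1)] by (simp add: GL_def units_of_def)
  then show ?thesis using \<rho> \<sigma> eq unfolding rep_equivalence_def by blast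
qed

section \<open>Irreducible representations with finite image\<close>

context Group.group begin

lemma finite_index_mono:
  assumes H: "finite_index G H" and K: "subgroup K G" "H \<subseteq> K"
  shows "finite_index G K"
proof (rule finite_index_if_finite_image[OF K(1), where f = "\<lambda>a. H #> a"])
  have sH: "subgroup H G" using H by (simp add: finite_index_def)
  show "finite ((\<lambda>a. H #> a) ` carrier G)" using H by (simp add: finite_index_def rcosets_image)
  show "a \<otimes> inv b \<in> K" if "a \<in> carrier G" "b \<in> carrier G" "H #> a = H #> b" for a b
    using rcos_eq_iff[OF sH] that K by blast
qed

lemma finite_irrepsD:
  assumes "\<sigma> \<in> finite_irreps G n"
  shows "irreducible_rep G n \<sigma>" "\<sigma> \<in> hom G (GL n)" "0 < n"
    "kernel G (GL n) \<sigma> \<lhd> G" "finite_index G (kernel G (GL n) \<sigma>)"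
    "g \<in> kernel G (GL n) \<sigma> \<longleftrightarrow> g \<in> carrier G \<and> \<sigma> g = 1\<^sub>m n"
proof -
  show "irreducible_rep G n \<sigma>" "finite_index G (kernel G (GL n) \<sigma>)"
    using assms by (auto simp: finite_irreps_def)
  then show hom: "\<sigma> \<in> hom G (GL n)" "0 < n" by (auto simp: irreducible_rep_def)
  then interpret group_hom G "GL n" \<sigma>
    using is_group group_GL by (simp add: group_hom_def group_hom_axioms_def)
  show "kernel G (GL n) \<sigma> \<lhd> G" by (rule normal_kernel)
  show "g \<in> kernel G (GL n) \<sigma> \<longleftrightarrow> g \<in> carrier G \<and> \<sigma> g = 1\<^sub>m n" by (simp add: kernel_def)
qed

lemma finite_irrepsI:
  assumes irr: "irreducible_rep G n \<sigma>" and N: "finite_index G N" and triv: "\<And>g. g \<in> N \<Longrightarrow> \<sigma> g = 1\<^sub>m n"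
  shows "\<sigma> \<in> finite_irreps G n"
proof -
  have hom: "\<sigma> \<in> hom G (GL n)" using irr by (simp add: irreducible_rep_def)
  then interpret h: group_hom G "GL n" \<sigma>
    using is_group group_GL by (simp add: group_hom_def group_hom_axioms_def)
  have "N \<subseteq> carrier G" using N by (auto simp: finite_index_def dest: subgroup.subset)
  then have "N \<subseteq> kernel G (GL n) \<sigma>" using triv by (auto simp: kernel_def)
  then show ?thesis
    using irr finite_index_mono[OF N h.subgroup_kernel] by (simp add: finite_irreps_def)
qed

section \<open>The permutation representation on functions on the cosets\<close>

lemma coset_shift_in:
  assumes "subgroup N G" "C \<in> rcosets N" "g \<in> carrier G"
  shows "C #> g \<in> rcosets N"
proof -
  obtain y where "y \<in> carrier G" "C = N #> y" using assms(2) by (auto simp: rcosets_image)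
  then show ?thesis using assms by (auto simp: rcosets_image coset_mult_assoc subgroup.subset)
qed

lemma rcoset_subset: "subgroup N G \<Longrightarrow> C \<in> rcosets N \<Longrightarrow> C \<subseteq> carrier G"
  using rcosets_part_G[of N] by (metis Union_upper)

lemma coset_shift_mult:
  assumes "subgroup N G" "C \<in> rcosets N" "g \<in> carrier G" "h \<in> carrier G"
  shows "(C #> g) #> h = C #> (g \<otimes> h)"
  by (rule coset_mult_assoc[OF rcoset_subset[OF assms(1,2)] assms(3,4)])

lemma coset_shift_one: "subgroup N G \<Longrightarrow> C \<in> rcosets N \<Longrightarrow> C #> \<one> = C"
  by (rule coset_mult_one[OF rcoset_subset])

lemma coset_sum_shift:
  assumes N: "subgroup N G" and g: "g \<in> carrier G"
  shows "(\<Sum>C\<in>rcosets N. f (C #> g)) = (\<Sum>C\<in>rcosets N. f C)"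
  by (rule sum.reindex_bij_witness[where i = "\<lambda>C. C #> inv g" and j = "\<lambda>C. C #> g"])
    (use N g in \<open>simp_all add: coset_shift_in coset_shift_mult coset_shift_one\<close>)

text \<open>Right translation in the argument, which gives a left action on functions.\<close>

definition coset_act :: "'a set \<Rightarrow> 'a \<Rightarrow> ('a set \<Rightarrow> complex) \<Rightarrow> 'a set \<Rightarrow> complex" where
  "coset_act N g F = (\<lambda>C. if C \<in> rcosets N then F (C #> g) else 0)"

lemma linear_rep_coset_act:
  assumes N: "finite_index G N"
  shows "linear_rep G (coset_act N) (supp_space (rcosets N))"
  unfolding linear_rep_def invariant_def
proof (intro conjI ballI allI exI)
  have sN: "subgroup N G" and fin: "finite (rcosets N)" using N by (auto simp: finite_index_def)
  show "finite (delta ` (rcosets N))" "supp_space (rcosets N) \<subseteq> fn.span (delta ` (rcosets N))"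
    using fin supp_space_span by auto
  show "fn.subspace (supp_space (rcosets N))" by (rule subspace_supp_space)
  show "coset_act N \<one> F = F" if "F \<in> supp_space (rcosets N)" for F
    using that by (auto simp: coset_act_def supp_space_def coset_shift_one[OF sN] fun_eq_iff)
  show "coset_act N (g \<otimes> h) F = coset_act N g (coset_act N h F)"
    if "g \<in> carrier G" "h \<in> carrier G" for g h F
    using that by (auto simp: coset_act_def coset_shift_in[OF sN] coset_shift_mult[OF sN] fun_eq_iff)
qed (auto simp: coset_act_def supp_space_def fun_eq_iff)

text \<open>For normal \<open>N\<close>, right translation by an element of \<open>N\<close> fixes
  each coset. Hence every constituent of this representation is trivial on \<open>N\<close> and has
  finite image.\<close>

lemma coset_act_normal:
  assumes N: "N \<lhd> G" and n: "n \<in> N" and F: "F \<in> supp_space (rcosets N)"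
  shows "coset_act N n F = F"
proof -
  have sN: "subgroup N G" using N by (rule normal_imp_subgroup)
  have nG: "n \<in> carrier G" using n sN by (rule subgroup.mem_carrier[rotated])
  have "C #> n = C" if "C \<in> rcosets N" for C
  proof -
    obtain y where y: "y \<in> carrier G" "C = N #> y" using \<open>C \<in> rcosets N\<close> by (auto simp: rcosets_image)
    have "y \<otimes> n \<otimes> inv y \<in> N" using N y n by (auto simp: normal_inv_iff)
    then have "N #> (y \<otimes> n) = N #> y" using rcos_eq_iff[OF sN] y nG by simp
    then show ?thesis using y nG sN by (simp add: coset_mult_assoc subgroup.subset)
  qed
  then show ?thesis using F by (auto simp: coset_act_def supp_space_def fun_eq_iff)
qed

text \<open>The functional \<open>F \<mapsto> \<Sum>s. a s * F (N x\<^sub>s)\<close> on functions on the cosets kills all irreducible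
  submodules. It is the inner product with a function \<open>b\<close>, so an irreducible submodule of the
  module generated by \<open>b\<close> would be orthogonal to this module; hence \<open>b = 0\<close>.\<close>

lemma coset_sum_zero_if_irreps_zero:
  assumes N: "N \<lhd> G" "finite_index G N" and I: "finite I" "\<And>s. s \<in> I \<Longrightarrow> x s \<in> carrier G"
    and zero: "\<And>k \<sigma> i j. \<sigma> \<in> finite_irreps G k \<Longrightarrow> i < k \<Longrightarrow> j < k \<Longrightarrow>
        (\<Sum>s\<in>I. a s * \<sigma> (x s) $$ (i, j)) = 0"
    and C: "C \<in> rcosets N"
  shows "(\<Sum>s\<in>{s \<in> I. x s \<in> C}. a s) = (0::complex)"
proof (rule ccontr)
  assume nz: "\<not> ?thesis"
  define Q where "Q = rcosets N"
  have sN: "subgroup N G" and finQ: "finite Q" using N by (auto simp: finite_index_def Q_def)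
  note rep = linear_rep_coset_act[OF N(2), folded Q_def]
  \<comment> \<open>With the conjugate, the Hermitian product of \<open>F\<close> with
    \<open>b\<close> is the functional itself.\<close>
  define b where "b = (\<lambda>C. if C \<in> Q then cnj (\<Sum>s\<in>{s \<in> I. x s \<in> C}. a s) else 0)"
  define M where "M = fn.span ((\<lambda>g. coset_act N g b) ` carrier G)"
  have bE: "b \<in> supp_space Q" by (simp add: b_def supp_space_def)
  have shift: "g \<in> carrier G \<Longrightarrow> F \<in> supp_space Q \<Longrightarrow> coset_act N g F \<in> supp_space Q" for g F
    using rep by (auto simp: linear_rep_def invariant_def)
  have ME: "M \<subseteq> supp_space Q" unfolding M_def
    using shift[OF _ bE] by (intro fn.span_minimal subspace_supp_space) auto
  have "invariant G (coset_act N) M" unfolding M_def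
  proof (rule invariant_span)
    fix g s assume g: "g \<in> carrier G" and "s \<in> (\<lambda>g. coset_act N g b) ` carrier G"
    then obtain h where h: "h \<in> carrier G" "s = coset_act N h b" by blast
    then have "coset_act N g s = coset_act N (g \<otimes> h) b" using rep g bE by (simp add: linear_rep_def)
    then show "coset_act N g s \<in> fn.span ((\<lambda>g. coset_act N g b) ` carrier G)"
      using g h by (auto intro!: fn.span_base)
  qed (use rep in \<open>auto simp: linear_rep_def\<close>)
  then have Mrep: "linear_rep G (coset_act N) M" by (rule linear_rep_sub[OF rep ME])
  have "coset_act N \<one> b = b" using rep bE by (simp add: linear_rep_def)
  then have bM: "b \<in> M" unfolding M_def by (metis fn.span_base imageI one_closed)
  have "b C \<noteq> 0" using nz C by (simp add: b_def Q_def del: cnj_sum)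
  then have "M \<noteq> {0}" using bM by auto
  then obtain U where U: "U \<subseteq> M" "linear_irrep G (coset_act N) U"
    using exists_irreducible_sub[OF Mrep] by blast
  have UE: "U \<subseteq> supp_space Q" using U ME by blast
  obtain k \<sigma> e where irr: "irreducible_rep G k \<sigma>"
    and e: "\<forall>i<k. e i \<in> U" "\<forall>w\<in>U. \<exists>c. w = (\<Sum>i<k. c i *f e i)"
    and act: "\<forall>g\<in>carrier G. \<forall>j<k. coset_act N g (e j) = (\<Sum>i<k. \<sigma> g $$ (i, j) *f e i)"
    and triv: "\<forall>g\<in>carrier G. (\<forall>w\<in>U. coset_act N g w = w) \<longrightarrow> \<sigma> g = 1\<^sub>m k"
    and "e 0 \<noteq> 0" and "\<forall>T. finite T \<longrightarrow> U \<subseteq> fn.span T \<longrightarrow> k \<le> card T"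
    by (rule irrep_matrix_form[OF is_group U(2)])
  have "\<sigma> n = 1\<^sub>m k" if "n \<in> N" for n
    using that sN UE coset_act_normal[OF N(1)]
      by (intro triv[rule_format]) (auto simp: Q_def subgroup.mem_carrier)
  then have \<sigma>: "\<sigma> \<in> finite_irreps G k" by (rule finite_irrepsI[OF irr N(2)])
  have kill: "(\<Sum>s\<in>I. a s * F (N #> x s)) = 0" if F: "F \<in> U" for F
  proof -
    obtain c where c: "F = (\<Sum>j<k. c j *f e j)" using e(2) F by blast
    have NQ: "N \<in> rcosets N" by (rule subgroup.subgroup_in_rcosets[OF sN is_group])
    \<comment> \<open>Evaluation at the coset \<open>N\<close> makes \<open>F\<close> a linear
      combination of matrix entries of \<open>\<sigma>\<close>, to which \<open>zero\<close>
      applies.\<close>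
    have "F (N #> g) = (\<Sum>j<k. c j * (\<Sum>i<k. \<sigma> g $$ (i, j) * e i N))" if g: "g \<in> carrier G" for g
    proof -
      have "F (N #> g) = coset_act N g F N" using NQ by (simp add: coset_act_def)
      also have "\<dots> = (\<Sum>j<k. c j * coset_act N g (e j) N)"
        unfolding c linear_rep_sum[OF rep g] by (simp add: sum_fun_apply)
      also have "\<dots> = (\<Sum>j<k. c j * (\<Sum>i<k. \<sigma> g $$ (i, j) * e i N))"
        using act g by (intro sum.cong) (auto simp: sum_fun_apply)
      finally show ?thesis .
    qed
    then have "(\<Sum>s\<in>I. a s * F (N #> x s)) = (\<Sum>s\<in>I. \<Sum>j<k. \<Sum>i<k. (c j * e i N) * (a s * \<sigma> (x s) $$ (i, j)))"
      using I by (intro sum.cong) (auto simp: sum_distrib_left algebra_simps)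
    also have "\<dots> = (\<Sum>j<k. \<Sum>s\<in>I. \<Sum>i<k. (c j * e i N) * (a s * \<sigma> (x s) $$ (i, j)))"
      by (rule sum.swap)
    also have "\<dots> = (\<Sum>j<k. \<Sum>i<k. \<Sum>s\<in>I. (c j * e i N) * (a s * \<sigma> (x s) $$ (i, j)))"
      by (intro sum.cong refl sum.swap)
    also have "\<dots> = 0" using zero[OF \<sigma>] by (simp add: sum_distrib_left[symmetric])
    finally show ?thesis .
  qed
  have inner: "(\<Sum>C\<in>Q. F C * cnj (b C)) = (\<Sum>s\<in>I. a s * F (N #> x s))" for F
  proof -
    have "(\<Sum>C\<in>Q. F C * cnj (b C)) = (\<Sum>C\<in>Q. \<Sum>s\<in>I. if x s \<in> C then a s * F C else 0)"
      using I
        by (intro sum.cong) (auto simp: b_def sum_distrib_left mult.commute sum.inter_filter intro!: sum.cong)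
    also have "\<dots> = (\<Sum>s\<in>I. \<Sum>C\<in>Q. if x s \<in> C then a s * F C else 0)" by (rule sum.swap)
    also have "\<dots> = (\<Sum>s\<in>I. \<Sum>C\<in>Q. if C = N #> x s then a s * F C else 0)"
    proof (intro sum.cong refl)
      fix s C assume s: "s \<in> I" and "C \<in> Q"
      then obtain y where y: "y \<in> carrier G" "C = N #> y" by (auto simp: Q_def rcosets_image)
      have "x s \<in> C \<longleftrightarrow> C = N #> x s"
        using repr_independence[OF _ y(1) sN] rcos_self[OF I(2)[OF s] sN] y by metis
      then show "(if x s \<in> C then a s * F C else 0) = (if C = N #> x s then a s * F C else 0)" by simp
    qed
    also have "\<dots> = (\<Sum>s\<in>I. a s * F (N #> x s))"
      using finQ I by (intro sum.cong) (auto simp: Q_def rcosets_image)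
    finally show ?thesis .
  qed
  have orth: "(\<Sum>C\<in>Q. F C * cnj (H C)) = 0" if F: "F \<in> U" and H: "H \<in> M" for F H
  proof -
    \<comment> \<open>The product is invariant under translation of the cosets, so \<open>g\<close>
      moves over to \<open>F\<close> as \<open>inv g\<close>, and \<open>U\<close> is stable under
      it.\<close>
    have "(\<Sum>C\<in>Q. F C * cnj (coset_act N g b C)) = 0" if g: "g \<in> carrier G" for g
    proof -
      have F': "coset_act N (inv g) F \<in> U"
        using U g F by (auto simp: linear_irrep_def linear_rep_def invariant_def)
      have "(\<Sum>C\<in>Q. F C * cnj (coset_act N g b C)) = (\<Sum>C\<in>Q. F ((C #> g) #> inv g) * cnj (b (C #> g)))"
        using g
          by (intro sum.cong) (auto simp: Q_def coset_act_def coset_shift_mult[OF sN] coset_shift_one[OF sN])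
      also have "\<dots> = (\<Sum>C\<in>Q. F (C #> inv g) * cnj (b C))"
        unfolding Q_def by (rule coset_sum_shift[OF sN g, of "\<lambda>C. F (C #> inv g) * cnj (b C)"])
      also have "\<dots> = (\<Sum>C\<in>Q. coset_act N (inv g) F C * cnj (b C))"
        by (intro sum.cong) (auto simp: coset_act_def Q_def)
      also have "\<dots> = 0" using kill[OF F'] inner by simp
      finally show ?thesis .
    qed
    then show ?thesis using H unfolding M_def
      by (intro fn.span_induct_alt[of H _ "\<lambda>H. (\<Sum>C\<in>Q. F C * cnj (H C)) = 0"])
        (auto simp: algebra_simps sum.distrib sum_distrib_left[symmetric] mult.left_commute)
  qed
  have "F = 0" if F: "F \<in> U" for F
  proof
    fix C
    have "(\<Sum>C\<in>Q. F C * cnj (F C)) = 0" using orth F U by blast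
    then have "(\<Sum>C\<in>Q. complex_of_real ((cmod (F C))\<^sup>2)) = 0"
      unfolding complex_norm_square .
    then have "(\<Sum>C\<in>Q. (cmod (F C))\<^sup>2) = 0" by (metis of_real_eq_0_iff of_real_sum)
    then have "C \<in> Q \<Longrightarrow> F C = 0" using finQ by (simp add: sum_nonneg_eq_0_iff)
    then show "F C = 0 C" using F UE by (auto simp: supp_space_def)
  qed
  moreover have "0 \<in> U" using U by (auto simp: linear_irrep_def linear_rep_def invariant_def fn.subspace_0)
  ultimately have "U = {0}" by blast
  then show False using U by (simp add: linear_irrep_def)
qed

section \<open>Separating elements by finite quotients and by irreducible representations\<close>

lemma residually_finite_avoid:
  assumes rf: "residually_finite G" and D: "finite D" "D \<subseteq> carrier G - {\<one>}"
  shows "\<exists>N. N \<lhd> G \<and> finite_index G N \<and> D \<inter> N = {}"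
proof -
  have "\<forall>d\<in>D. \<exists>N. N \<lhd> G \<and> finite_index G N \<and> d \<notin> N" using rf D unfolding residually_finite_def by blast
  then obtain N where N: "\<And>d. d \<in> D \<Longrightarrow> N d \<lhd> G \<and> finite_index G (N d) \<and> d \<notin> N d" by metis
  then show ?thesis using finite_index_INT[OF D(1), of N] normal_INT[of D N] by blast
qed

text \<open>Let \<open>\<one>\<close> have coefficient 1 and \<open>g\<close> coefficient -1. All
  irreducible representations kill this combination, so its sum over the coset \<open>N\<close>
  vanishes; but if \<open>g \<notin> N\<close>, only the coefficient 1 is there.\<close>

lemma irreps_separate:
  assumes rf: "residually_finite G" and g: "g \<in> carrier G"
    and triv: "\<And>k \<sigma>. \<sigma> \<in> finite_irreps G k \<Longrightarrow> \<sigma> g = 1\<^sub>m k"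
  shows "g = \<one>"
proof (rule ccontr)
  assume "g \<noteq> \<one>"
  then obtain N where N: "N \<lhd> G" "finite_index G N" "g \<notin> N"
    using residually_finite_avoid[OF rf, of "{g}"] g by auto
  have sN: "subgroup N G" using N by (simp add: finite_index_def)
  have "(\<Sum>s\<in>{s \<in> UNIV. (if s then \<one> else g) \<in> N}. if s then 1 else -1) = (0::complex)"
  proof (rule coset_sum_zero_if_irreps_zero[OF N(1,2)])
    show "N \<in> rcosets N" by (rule subgroup.subgroup_in_rcosets[OF sN is_group])
    fix k \<sigma> i j assume "\<sigma> \<in> finite_irreps G k"
    then have "\<sigma> g = \<sigma> \<one>" using triv hom_GL_D(2)[OF is_group] finite_irrepsD(2) by metis
    then show "(\<Sum>s\<in>UNIV. (if s then 1 else -1) * \<sigma> (if s then \<one> else g) $$ (i, j)) = 0"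
      by (simp add: UNIV_bool)
  qed (use g in auto)
  moreover have "(if s then \<one> else g) \<in> N \<longleftrightarrow> s" for s
    using N(3) subgroup.one_closed[OF sN] by simp
  then have "{s \<in> UNIV. (if s then \<one> else g) \<in> N} = {True}" by auto
  ultimately show False by simp
qed

section \<open>Bounded degrees\<close>

text \<open>The standard polynomial of degree exceeding \<open>k\<^sup>2\<close> vanishes on \<open>k \<times> k\<close> matrices: expanded along the
  paths of matrix indices, it is a sum of determinants with two equal rows.\<close>

lemma standard_identity:
  assumes \<sigma>: "\<sigma> \<in> hom G (GL k)" and g: "\<And>i. i < n \<Longrightarrow> g i \<in> carrier G" and kn: "k * k < n"
    and ab: "a < k" "b < k"
  shows "(\<Sum>p | p permutes {0..<n}. signof p * \<sigma> (list_prod (map (\<lambda>i. g (p i)) [0..<n])) $$ (a, b)) = 0"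
proof -
  note s = hom_GL_D[OF is_group \<sigma>]
  define P where "P = {p. p permutes {0..<n}}"
  have gP: "g (p i) \<in> carrier G" if "p \<in> P" "i < n" for p i
    using g that permutes_in_image[of p "{0..<n}" i] by (simp add: P_def)
  have wP: "list_prod (map (\<lambda>i. g (p i)) [m..<n]) \<in> carrier G" if "p \<in> P" for p m
    using gP[OF that] by (intro list_prod_closed) auto
  \<comment> \<open>The first \<open>m\<close> factors are already entries at positions
    \<open>e j\<close>; the other \<open>d\<close> factors still form a matrix product, read in row
    \<open>c\<close>. The claim covers arbitrary \<open>e\<close>, not only paths, so the induction
    need not track consecutive indices.\<close>
  have "(\<Sum>p\<in>P. signof p * ((\<Prod>j = 0..<m. \<sigma> (g (p j)) $$ e j) *
          \<sigma> (list_prod (map (\<lambda>i. g (p i)) [m..<n])) $$ (c, b))) = 0"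
    if "m + d = n" "\<And>j. j < m \<Longrightarrow> e j \<in> {..<k} \<times> {..<k}" "c < k" for m d c e
    using that
  proof (induction d arbitrary: m c e)
    case 0
    then have m: "m = n" by simp
    \<comment> \<open>Row \<open>j\<close> holds the entries at position \<open>e j\<close>, column
      \<open>i\<close> belongs to \<open>g i\<close>. There are only \<open>k * k < n\<close>
      positions, so two rows agree.\<close>
    define M where "M = mat n n (\<lambda>(j, i). \<sigma> (g i) $$ e j)"
    have M: "M \<in> carrier_mat n n" by (simp add: M_def)
    have "\<not> inj_on e {0..<n}"
    proof
      assume "inj_on e {0..<n}"
      moreover have "e ` {0..<n} \<subseteq> {..<k} \<times> {..<k}"
        using "0.prems"(2) m by (intro image_subsetI) (metis atLeastLessThan_iff)
      ultimately have "n \<le> card ({..<k} \<times> {..<k})"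
        using card_inj_on_le[of e "{0..<n}" "{..<k} \<times> {..<k}"] by simp
      then show False using kn by simp
    qed
    then obtain i j where ij: "i < n" "j < n" "i \<noteq> j" "e i = e j" by (auto simp: inj_on_def)
    then have "row M i = row M j" by (intro eq_vecI) (auto simp: M_def)
    then have "det M = 0" using det_identical_rows[OF M ij(3,1,2)] by simp
    also have "det M = (\<Sum>p\<in>P. signof p * (\<Prod>j = 0..<n. \<sigma> (g (p j)) $$ e j))"
      unfolding det_def'[OF M] P_def
      by (intro sum.cong refl arg_cong2[where f = "(*)"] prod.cong) (auto simp: M_def permutes_in_image)
    finally have "(\<Sum>p\<in>P. signof p * (\<Prod>j = 0..<n. \<sigma> (g (p j)) $$ e j)) * 1\<^sub>m k $$ (c, b) = 0" by simp
    then show ?case by (simp add: m s(2) sum_distrib_right mult.assoc)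
  next
    case (Suc d)
    have mn: "m < n" using Suc.prems by simp
    have "signof p * ((\<Prod>j = 0..<m. \<sigma> (g (p j)) $$ e j) * \<sigma> (list_prod (map (\<lambda>i. g (p i)) [m..<n])) $$ (c, b))
        = (\<Sum>l<k. signof p * ((\<Prod>j = 0..<Suc m. \<sigma> (g (p j)) $$ (e(m := (c, l))) j) *
            \<sigma> (list_prod (map (\<lambda>i. g (p i)) [Suc m..<n])) $$ (l, b)))" if p: "p \<in> P" for p
    proof -
      have "\<sigma> (list_prod (map (\<lambda>i. g (p i)) [m..<n])) $$ (c, b) =
          (\<Sum>l<k. \<sigma> (g (p m)) $$ (c, l) * \<sigma> (list_prod (map (\<lambda>i. g (p i)) [Suc m..<n])) $$ (l, b))"
        using mat_mult_index[OF s(1) s(1) Suc.prems(3) ab(2)] gP[OF p mn] wP[OF p, of "Suc m"]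
        by (simp add: upt_conv_Cons[OF mn] s(3))
      then show ?thesis by (simp add: sum_distrib_left algebra_simps)
    qed
    then have "(\<Sum>p\<in>P. signof p * ((\<Prod>j = 0..<m. \<sigma> (g (p j)) $$ e j) *
        \<sigma> (list_prod (map (\<lambda>i. g (p i)) [m..<n])) $$ (c, b)))
        = (\<Sum>p\<in>P. \<Sum>l<k. signof p * ((\<Prod>j = 0..<Suc m. \<sigma> (g (p j)) $$ (e(m := (c, l))) j) *
            \<sigma> (list_prod (map (\<lambda>i. g (p i)) [Suc m..<n])) $$ (l, b)))"
      by (intro sum.cong) auto
    also have "\<dots> = (\<Sum>l<k. \<Sum>p\<in>P. signof p * ((\<Prod>j = 0..<Suc m. \<sigma> (g (p j)) $$ (e(m := (c, l))) j) *
            \<sigma> (list_prod (map (\<lambda>i. g (p i)) [Suc m..<n])) $$ (l, b)))" by (rule sum.swap)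
    also have "\<dots> = 0"
      using Suc.prems by (intro sum.neutral ballI Suc.IH) (auto simp: less_Suc_eq)
    finally show ?case .
  qed
  from this[of 0 n _ a] show ?thesis using ab by (simp add: P_def)
qed

text \<open>If no other order gave the same product, a normal subgroup of finite index would
  separate \<open>w id\<close> from all other \<open>w p\<close>. The coset of \<open>w id\<close>
  would then carry the single coefficient 1, although the standard identity makes its coefficient
  sum zero.\<close>

lemma reorderable_if_degrees_bounded:
  assumes rf: "residually_finite G" and d: "\<And>k. d \<le> k \<Longrightarrow> finite_irreps G k = {}"
    and xs: "distinct xs" "set xs \<subseteq> carrier G" "length xs = d * d + 1"
  shows "reorderable xs"
proof (rule ccontr)
  assume nr: "\<not> reorderable xs"
  define n where "n = length xs"
  define P where "P = {p. p permutes {0..<n}}"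
  define w where "w p = list_prod (map (\<lambda>i. xs ! p i) [0..<n])" for p
  have finP: "finite P" by (simp add: P_def finite_permutations)
  have w: "w p \<in> carrier G" if "p \<in> P" for p
    unfolding w_def using that xs permutes_in_image[of p "{0..<n}"]
    by (intro list_prod_closed) (auto simp: P_def n_def)
  have id: "id \<in> P" "w id = list_prod xs"
    by (auto simp: P_def permutes_id w_def n_def map_nth)
  \<comment> \<open>Since \<open>xs\<close> is distinct, a permutation other than \<open>id\<close>
    yields a different list, so equal products would be a reordering.\<close>
  have ne: "w p \<noteq> w id" if p: "p \<in> P" "p \<noteq> id" for p
  proof
    assume eq: "w p = w id"
    define ys where "ys = map (\<lambda>i. xs ! p i) [0..<n]"
    have perm: "p permutes {0..<n}" using p by (simp add: P_def)
    have pim: "p ` {0..<n} = {0..<n}" using permutes_image[OF perm] .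
    have "set ys = (!) xs ` p ` {0..<n}" by (auto simp: ys_def)
    also have "\<dots> = set xs" unfolding pim by (auto simp: n_def set_conv_nth)
    finally have "set ys = set xs" .
    moreover have "distinct ys"
      using permutes_inj[OF perm] permutes_in_image[OF perm] xs(1)
      by (auto simp: ys_def distinct_map inj_on_def n_def nth_eq_iff_index_eq)
    moreover have "ys \<noteq> xs"
    proof
      assume "ys = xs"
      have "p i = i" for i
      proof (cases "i < n")
        case True
        then have "xs ! p i = xs ! i"
          using \<open>ys = xs\<close> by (metis (no_types, lifting) add_0 length_map length_upt nth_map nth_upt diff_zero ys_def)
        then show ?thesis
          using True xs(1) permutes_in_image[OF perm, of i] by (simp add: nth_eq_iff_index_eq n_def)
      next
        case False
        then show ?thesis using permutes_not_in[OF perm] by simp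
      qed
      then show False using p(2) by auto
    qed
    moreover have "list_prod ys = list_prod xs" using eq id by (simp add: w_def ys_def)
    ultimately show False using nr unfolding reorderable_def by blast
  qed
  define D where "D = (\<lambda>p. w p \<otimes> inv (w id)) ` (P - {id})"
  have "finite D" using finP by (simp add: D_def)
  moreover have "D \<subseteq> carrier G - {\<one>}"
  proof -
    have "w p \<otimes> inv (w id) \<noteq> \<one>" if "p \<in> P - {id}" for p
      using ne[of p] w[of p] w[OF id(1)] that by (metis DiffE inv_equality inv_inv inv_closed singletonI)
    moreover have "list_prod xs \<in> carrier G" using w id by metis
    ultimately show ?thesis using w id by (auto simp: D_def)
  qed
  ultimately obtain N where N: "N \<lhd> G" "finite_index G N" "D \<inter> N = {}"
    using residually_finite_avoid[OF rf] by blast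
  have sN: "subgroup N G" using N by (simp add: finite_index_def)
  have "(\<Sum>p\<in>{p \<in> P. w p \<in> N #> w id}. signof p) = (0::complex)"
  proof (rule coset_sum_zero_if_irreps_zero[OF N(1,2) finP w])
    show "N #> w id \<in> rcosets N" using w[OF id(1)] by (auto simp: rcosets_image)
    fix k \<sigma> i j assume \<sigma>: "\<sigma> \<in> finite_irreps G k" and ij: "i < k" "j < k"
    have "k < d" using d[of k] \<sigma> by (cases "d \<le> k") auto
    then have "k * k \<le> d * d" by (intro mult_le_mono) auto
    then have "k * k < n" using xs(3) by (simp add: n_def)
    then show "(\<Sum>p\<in>P. signof p * \<sigma> (w p) $$ (i, j)) = 0"
      using standard_identity[OF finite_irrepsD(2)[OF \<sigma>], of n "(!) xs"] xs(2) ij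
      by (simp add: P_def w_def n_def nth_mem subset_iff)
  qed
  moreover have "{p \<in> P. w p \<in> N #> w id} = {id}"
  proof -
    have "w p \<notin> N #> w id" if "p \<in> P" "p \<noteq> id" for p
    proof
      assume "w p \<in> N #> w id"
      then have "w p \<otimes> inv (w id) \<in> N"
        using subgroup.rcos_module_imp[OF sN is_group w[OF id(1)]] by blast
      then show False using N(3) that by (auto simp: D_def)
    qed
    then show ?thesis using id rcos_self[OF w[OF id(1)] sN] by auto
  qed
  ultimately show False by (simp add: signof_id)
qed

section \<open>Finitely many classes of irreducible representations\<close>

lemma num_irreps_eq_0_iff: "num_irreps G n = 0 \<longleftrightarrow> finite_irreps G n = {}"
proof
  assume "num_irreps G n = 0"
  then have "finite_irreps G n // rep_equivalence G n = {}"
    by (auto simp: num_irreps_def ecard_def zero_enat_def split: if_splits)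
  then show "finite_irreps G n = {}" by (auto simp: quotient_def)
next
  assume "finite_irreps G n = {}"
  then show "num_irreps G n = 0" by (simp add: num_irreps_def ecard_def quotient_def zero_enat_def)
qed

lemma num_irreps_infinite_iff:
  "num_irreps G n = \<infinity> \<longleftrightarrow> infinite (finite_irreps G n // rep_equivalence G n)"
  by (simp add: num_irreps_def ecard_def)

lemma trivial_if_equivalent:
  assumes eq: "(\<rho>, \<sigma>) \<in> rep_equivalence G n" and g: "g \<in> carrier G" "\<rho> g = 1\<^sub>m n"
  shows "\<sigma> g = 1\<^sub>m n"
proof -
  interpret GL: Group.group "GL n" by (rule group_GL)
  obtain T where T: "T \<in> carrier (GL n)" "T * \<rho> g = \<sigma> g * T" and \<sigma>: "\<sigma> \<in> finite_irreps G n"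
    using eq g by (auto simp: rep_equivalence_def)
  have s: "\<sigma> g \<in> carrier (GL n)" using hom_in_carrier[OF finite_irrepsD(2)[OF \<sigma>] g(1)] .
  have "\<one>\<^bsub>GL n\<^esub> \<otimes>\<^bsub>GL n\<^esub> T = \<sigma> g \<otimes>\<^bsub>GL n\<^esub> T"
    using T g by (auto simp: carrier_GL)
  then have "\<one>\<^bsub>GL n\<^esub> = \<sigma> g" using T(1) s GL.right_cancel GL.one_closed by blast
  then show ?thesis by simp
qed

text \<open>Equivalent representations have the same kernel, so one representative from each of the
  finitely many classes suffices.\<close>

lemma common_kernel:
  assumes D: "finite D" "\<And>i. i \<in> D \<Longrightarrow> num_irreps G i \<noteq> \<infinity>"
  shows "\<exists>K. K \<lhd> G \<and> finite_index G K \<and> (\<forall>i\<in>D. \<forall>\<sigma>\<in>finite_irreps G i. \<forall>g\<in>K. \<sigma> g = 1\<^sub>m i)"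
proof -
  define r where "r A = (SOME \<sigma>. \<sigma> \<in> A)" for A :: "('a \<Rightarrow> complex mat) set"
  define J where "J = (SIGMA i:D. finite_irreps G i // rep_equivalence G i)"
  define K where "K = carrier G \<inter> (\<Inter>(i, A)\<in>J. kernel G (GL i) (r A))"
  have r: "r A \<in> A" "r A \<in> finite_irreps G i" if "A \<in> finite_irreps G i // rep_equivalence G i" for i A
  proof -
    note eqv = equiv_rep_equivalence[OF is_group, of i]
    have "A \<noteq> {}" using in_quotient_imp_non_empty[OF eqv that] .
    then show "r A \<in> A" unfolding r_def by (simp add: some_in_eq)
    then show "r A \<in> finite_irreps G i" using in_quotient_imp_subset[OF eqv that] by blast
  qed
  have "finite J" using D by (auto simp: J_def num_irreps_infinite_iff)
  then have "finite_index G K" unfolding K_def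
    by (rule finite_index_INT) (use r finite_irrepsD(5) in \<open>auto simp: J_def\<close>)
  moreover have "K \<lhd> G" unfolding K_def
    by (rule normal_INT) (use r finite_irrepsD(4) in \<open>auto simp: J_def\<close>)
  moreover have "\<sigma> g = 1\<^sub>m i" if i: "i \<in> D" and \<sigma>: "\<sigma> \<in> finite_irreps G i" and g: "g \<in> K" for i \<sigma> g
  proof -
    note eqv = equiv_rep_equivalence[OF is_group, of i]
    define A where "A = rep_equivalence G i `` {\<sigma>}"
    have A: "A \<in> finite_irreps G i // rep_equivalence G i" using \<sigma> by (auto simp: A_def quotient_def)
    then have "g \<in> kernel G (GL i) (r A)" using g i by (force simp: K_def J_def)
    then have "g \<in> carrier G" "r A g = 1\<^sub>m i" using finite_irrepsD(6)[OF r(2)[OF A]] by auto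
    moreover have "(r A, \<sigma>) \<in> rep_equivalence G i"
      using r(1)[OF A] eqv by (auto simp: A_def equiv_def dest: symD)
    ultimately show ?thesis using trivial_if_equivalent by blast
  qed
  ultimately show ?thesis by blast
qed

text \<open>Pairing a linear relation with \<open>w a\<close> isolates the coefficient of
  \<open>f a\<close>. So the \<open>f a\<close> are independent in a space spanned by
  \<open>card Q\<close> functions.\<close>

lemma card_biorthogonal_le:
  fixes f w :: "'x \<Rightarrow> 'q \<Rightarrow> complex"
  assumes Q: "finite Q" and A: "finite A" and f: "\<And>a. a \<in> A \<Longrightarrow> f a \<in> supp_space Q"
    and bi: "\<And>a b. a \<in> A \<Longrightarrow> b \<in> A \<Longrightarrow> (\<Sum>c\<in>Q. w a c * f b c) \<noteq> 0 \<longleftrightarrow> a = b"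
  shows "card A \<le> card Q"
proof -
  have inj: "inj_on f A"
  proof (rule inj_onI)
    fix a b assume ab: "a \<in> A" "b \<in> A" "f a = f b"
    then have "(\<Sum>c\<in>Q. w a c * f b c) \<noteq> 0" using bi[of a a] by simp
    then show "a = b" using bi ab by simp
  qed
  have "fn.independent (f ` A)"
  proof (rule fn.independent_if_scalars_zero)
    show "finite (f ` A)" using A by simp
    fix u x assume s: "(\<Sum>x\<in>f ` A. u x *f x) = 0" and "x \<in> f ` A"
    then obtain a where a: "a \<in> A" "x = f a" by blast
    have z: "(\<Sum>b\<in>A. u (f b) *f f b) = 0" using s inj by (simp add: sum.reindex)
    have "0 = (\<Sum>c\<in>Q. w a c * (\<Sum>b\<in>A. u (f b) *f f b) c)" unfolding z by simp
    also have "\<dots> = (\<Sum>c\<in>Q. \<Sum>b\<in>A. u (f b) * (w a c * f b c))"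
      by (simp add: sum_fun_apply sum_distrib_left mult.left_commute)
    also have "\<dots> = (\<Sum>b\<in>A. \<Sum>c\<in>Q. u (f b) * (w a c * f b c))" by (rule sum.swap)
    also have "\<dots> = (\<Sum>b\<in>A. u (f b) * (\<Sum>c\<in>Q. w a c * f b c))" by (simp add: sum_distrib_left)
    also have "\<dots> = (\<Sum>b\<in>A. if b = a then u (f a) * (\<Sum>c\<in>Q. w a c * f a c) else 0)"
      using bi[OF a(1)] by (intro sum.cong) auto
    also have "\<dots> = u (f a) * (\<Sum>c\<in>Q. w a c * f a c)" using A a by simp
    finally show "u x = 0" using bi[OF a(1) a(1)] a by simp
  qed
  moreover have "f ` A \<subseteq> fn.span (delta ` Q)" using f supp_space_span[OF Q] by blast
  ultimately have "card (f ` A) \<le> card (delta ` Q)"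
    using fn.independent_span_bound[of "delta ` Q" "f ` A"] Q by blast
  also have "\<dots> \<le> card Q" using Q by (rule card_image_le)
  finally show ?thesis using card_image[OF inj] by simp
qed

text \<open>Averaging \<open>\<sigma>(x\<^sup>-\<^sup>1) E \<rho>(x)\<close> over the cosets, with \<open>E\<close> a matrix unit, gives an intertwiner
  from \<open>\<rho>\<close> to \<open>\<sigma>\<close>.\<close>

lemma averaged_coefficients:
  assumes N: "N \<lhd> G" "finite_index G N"
    and \<rho>: "\<rho> \<in> finite_irreps G n" "\<And>g. g \<in> N \<Longrightarrow> \<rho> g = 1\<^sub>m n"
    and \<sigma>: "\<sigma> \<in> finite_irreps G n" "\<And>g. g \<in> N \<Longrightarrow> \<sigma> g = 1\<^sub>m n"
    and r: "\<And>C. C \<in> rcosets N \<Longrightarrow> r C \<in> C"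
    and ab: "a < n" "b < n" "i < n" "j < n"
    and ne: "(\<rho>, \<sigma>) \<notin> rep_equivalence G n"
  shows "(\<Sum>C\<in>rcosets N. \<sigma> (inv (r C)) $$ (i, a) * \<rho> (r C) $$ (b, j)) = 0"
proof -
  note R = hom_GL_D[OF is_group finite_irrepsD(2)[OF \<rho>(1)]]
  note S = hom_GL_D[OF is_group finite_irrepsD(2)[OF \<sigma>(1)]]
  have sN: "subgroup N G" using N by (simp add: finite_index_def)
  have rG: "r C \<in> carrier G" if "C \<in> rcosets N" for C using r rcoset_subset[OF sN] that by blast
  define T where "T = mat n n (\<lambda>(i, j). \<Sum>C\<in>rcosets N. \<sigma> (inv (r C)) $$ (i, a) * \<rho> (r C) $$ (b, j))"
  have T: "T \<in> carrier_mat n n" by (simp add: T_def)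
  have "T * \<rho> g = \<sigma> g * T" if g: "g \<in> carrier G" for g
  proof (rule eq_matI)
    fix i j assume "i < dim_row (\<sigma> g * T)" "j < dim_col (\<sigma> g * T)"
    then have ij: "i < n" "j < n" using S(1)[OF g] T by auto
    \<comment> \<open>The summand after absorbing \<open>\<sigma> g\<close>. As
      \<open>\<rho>\<close> and \<open>\<sigma>\<close> are trivial on \<open>N\<close>, it depends
      only on the coset of \<open>x\<close>, so the chosen representative may be replaced by any
      other.\<close>
    define H where "H x = \<sigma> (g \<otimes> inv x) $$ (i, a) * \<rho> x $$ (b, j)" for x
    have H: "H (r (N #> x)) = H x" if x: "x \<in> carrier G" for x
    proof -
      have C: "N #> x \<in> rcosets N" using x by (auto simp: rcosets_image)
      define y where "y = r (N #> x)"
      have yx: "y \<in> N #> x" unfolding y_def by (rule r[OF C])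
      then obtain m where m: "m \<in> N" "y = m \<otimes> x" by (auto simp: r_coset_def)
      have mG: "m \<in> carrier G" using m sN by (meson subgroup.mem_carrier)
      have im: "inv m \<in> N" using m sN by (simp add: subgroup.m_inv_closed)
      have "\<rho> y = \<rho> x" using m x mG R(3)[OF mG x] \<rho>(2)[OF m(1)] R(1)[OF x] by simp
      moreover have "\<sigma> (g \<otimes> inv y) = \<sigma> (g \<otimes> inv x)"
      proof -
        have "g \<otimes> inv y = (g \<otimes> inv x) \<otimes> inv m" using m x mG g by (simp add: inv_mult_group m_assoc)
        then show ?thesis using S(3)[of "g \<otimes> inv x" "inv m"] \<sigma>(2)[OF im] S(1)[of "g \<otimes> inv x"] g x mG by simp
      qed
      ultimately show ?thesis by (simp add: H_def y_def[symmetric])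
    qed
    have "(\<sigma> g * T) $$ (i, j) =
        (\<Sum>l<n. \<Sum>C\<in>rcosets N. \<sigma> g $$ (i, l) * \<sigma> (inv (r C)) $$ (l, a) * \<rho> (r C) $$ (b, j))"
      using mat_mult_index[OF S(1)[OF g] T ij] ij by (simp add: T_def sum_distrib_left mult.assoc)
    also have "\<dots> = (\<Sum>C\<in>rcosets N. \<Sum>l<n. \<sigma> g $$ (i, l) * \<sigma> (inv (r C)) $$ (l, a) * \<rho> (r C) $$ (b, j))"
      by (rule sum.swap)
    also have "\<dots> = (\<Sum>C\<in>rcosets N. H (r C))"
    proof (rule sum.cong[OF refl])
      fix C assume C: "C \<in> rcosets N"
      have "\<sigma> (g \<otimes> inv (r C)) $$ (i, a) = (\<Sum>l<n. \<sigma> g $$ (i, l) * \<sigma> (inv (r C)) $$ (l, a))"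
        using S(3)[OF g, of "inv (r C)"] mat_mult_index[OF S(1)[OF g] S(1) ij(1) ab(1), of "inv (r C)"] rG[OF C]
          by simp
      then show "(\<Sum>l<n. \<sigma> g $$ (i, l) * \<sigma> (inv (r C)) $$ (l, a) * \<rho> (r C) $$ (b, j)) = H (r C)"
        by (simp add: H_def sum_distrib_right)
    qed
    \<comment> \<open>Replacing \<open>C\<close> by \<open>C #> g\<close> turns
      \<open>g \<otimes> inv x\<close> into \<open>inv x\<close> and \<open>\<rho> x\<close> into
      \<open>\<rho> x * \<rho> g\<close>, which moves \<open>g\<close> to the other side of
      \<open>T\<close>.\<close>
    also have "\<dots> = (\<Sum>C\<in>rcosets N. H (r (C #> g)))" by (rule coset_sum_shift[OF sN g, symmetric])
    also have "\<dots> = (\<Sum>C\<in>rcosets N. \<sigma> (inv (r C)) $$ (i, a) * (\<rho> (r C) * \<rho> g) $$ (b, j))"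
    proof (rule sum.cong[OF refl])
      fix C assume C: "C \<in> rcosets N"
      obtain y where y: "y \<in> carrier G" "C = N #> y" using C by (auto simp: rcosets_image)
      have "C = N #> r C" using repr_independence[OF _ y(1) sN] r[OF C] y by metis
      then have "C #> g = N #> (r C \<otimes> g)"
        using coset_mult_assoc[of N "r C" g] subgroup.subset[OF sN] rG[OF C] g by metis
      then have "H (r (C #> g)) = H (r C \<otimes> g)" using H rG[OF C] g by simp
      also have "g \<otimes> inv (r C \<otimes> g) = inv (r C)"
        using rG[OF C] g by (simp add: inv_mult_group m_assoc[symmetric])
      then have "H (r C \<otimes> g) = \<sigma> (inv (r C)) $$ (i, a) * (\<rho> (r C) * \<rho> g) $$ (b, j)"
        using R(3)[OF rG[OF C] g] by (simp add: H_def)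
      finally show "H (r (C #> g)) = \<sigma> (inv (r C)) $$ (i, a) * (\<rho> (r C) * \<rho> g) $$ (b, j)" .
    qed
    also have "\<dots> = (\<Sum>C\<in>rcosets N. \<Sum>l<n. \<sigma> (inv (r C)) $$ (i, a) * \<rho> (r C) $$ (b, l) * \<rho> g $$ (l, j))"
      using mat_mult_index[OF R(1) R(1)[OF g] ab(2) ij(2)] rG
      by (intro sum.cong) (simp_all add: sum_distrib_left mult.assoc)
    also have "\<dots> = (\<Sum>l<n. \<Sum>C\<in>rcosets N. \<sigma> (inv (r C)) $$ (i, a) * \<rho> (r C) $$ (b, l) * \<rho> g $$ (l, j))"
      by (rule sum.swap)
    also have "\<dots> = (T * \<rho> g) $$ (i, j)"
      using mat_mult_index[OF T R(1)[OF g] ij] ij by (simp add: T_def sum_distrib_right)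
    finally show "(T * \<rho> g) $$ (i, j) = (\<sigma> g * T) $$ (i, j)" by simp
  qed (use T R(1)[OF g] S(1)[OF g] in auto)
  then have "T = 0\<^sub>m n n"
    using rep_equivalence_if_intertwiner[OF is_group \<rho>(1) \<sigma>(1) T] ne by blast
  then have "T $$ (i, j) = 0" using ab by simp
  then show ?thesis using ab by (simp add: T_def)
qed

text \<open>By orthogonality, suitable matrix coefficients of inequivalent representations are
  independent functions on the cosets. So the index of \<open>N\<close> bounds the number of
  classes.\<close>

lemma finitely_many_irreps_of_quotient:
  assumes N: "N \<lhd> G" "finite_index G N" and triv: "\<And>\<sigma> g. \<sigma> \<in> finite_irreps G n \<Longrightarrow> g \<in> N \<Longrightarrow> \<sigma> g = 1\<^sub>m n"
  shows "num_irreps G n \<noteq> \<infinity>"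
proof
  assume "num_irreps G n = \<infinity>"
  then obtain \<A> where \<A>: "\<A> \<subseteq> finite_irreps G n // rep_equivalence G n" "finite \<A>"
      "card \<A> = Suc (card (rcosets N))"
    unfolding num_irreps_infinite_iff using infinite_arbitrarily_large by blast
  note eqv = equiv_rep_equivalence[OF is_group, of n]
  define Q where "Q = rcosets N"
  have sN: "subgroup N G" and finQ: "finite Q" using N by (auto simp: finite_index_def Q_def)
  define s where "s A = (SOME \<sigma>. \<sigma> \<in> A)" for A :: "('a \<Rightarrow> complex mat) set"
  have s: "s A \<in> A" "s A \<in> finite_irreps G n" if "A \<in> \<A>" for A
  proof -
    have A: "A \<in> finite_irreps G n // rep_equivalence G n" using that \<A> by blast
    show "s A \<in> A" unfolding s_def using in_quotient_imp_non_empty[OF eqv A] by (simp add: some_in_eq)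
    then show "s A \<in> finite_irreps G n" using in_quotient_imp_subset[OF eqv A] by blast
  qed
  have ineq: "(s A, s B) \<notin> rep_equivalence G n" if "A \<in> \<A>" "B \<in> \<A>" "A \<noteq> B" for A B
    using quotient_eqI[OF eqv _ _ s(1)[OF that(1)] s(1)[OF that(2)]] that \<A> by blast
  define r where "r C = (SOME x. x \<in> C)" for C :: "'a set"
  have r: "r C \<in> C" if "C \<in> Q" for C
    unfolding r_def using subgroup.rcosets_non_empty[OF sN, of C] that by (simp add: some_in_eq Q_def)
  have rG: "r C \<in> carrier G" if "C \<in> Q" for C using r rcoset_subset[OF sN] that unfolding Q_def by blast
  \<comment> \<open>Summed over \<open>a\<close>, each coset contributes the (0, 0) entry of the
    identity matrix. The total is \<open>card Q\<close>, which is nonzero, so some \<open>a\<close>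
    has a nonzero sum.\<close>
  have "\<exists>a<n. (\<Sum>C\<in>Q. s A (inv (r C)) $$ (0, a) * s A (r C) $$ (a, 0)) \<noteq> 0" if A: "A \<in> \<A>" for A
  proof (rule ccontr)
    assume "\<not> ?thesis"
    then have z: "(\<Sum>a<n. \<Sum>C\<in>Q. s A (inv (r C)) $$ (0, a) * s A (r C) $$ (a, 0)) = 0" by simp
    note R = hom_GL_D[OF is_group finite_irrepsD(2)[OF s(2)[OF A]]]
    have n: "0 < n" using finite_irrepsD(3)[OF s(2)[OF A]] .
    have "(\<Sum>a<n. s A (inv (r C)) $$ (0, a) * s A (r C) $$ (a, 0)) = 1" if C: "C \<in> Q" for C
    proof -
      have "s A (inv (r C)) * s A (r C) = 1\<^sub>m n" using R(2) R(3)[of "inv (r C)" "r C"] rG[OF C] by simp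
      then show ?thesis
        using mat_mult_index[OF R(1) R(1) n n, of "inv (r C)" "r C"] rG[OF C] n by simp
    qed
    then have "(\<Sum>C\<in>Q. \<Sum>a<n. s A (inv (r C)) $$ (0, a) * s A (r C) $$ (a, 0)) = of_nat (card Q)" by simp
    then have "of_nat (card Q) = (0::complex)" using z by (subst (asm) sum.swap) simp
    moreover have "N \<in> Q" unfolding Q_def by (rule subgroup.subgroup_in_rcosets[OF sN is_group])
    ultimately show False using finQ by auto
  qed
  then have "\<forall>A\<in>\<A>. \<exists>a. a < n \<and> (\<Sum>C\<in>Q. s A (inv (r C)) $$ (0, a) * s A (r C) $$ (a, 0)) \<noteq> 0" by blast
  from bchoice[OF this] obtain a where a: "\<And>A. A \<in> \<A> \<Longrightarrow> a A < n"
      "\<And>A. A \<in> \<A> \<Longrightarrow> (\<Sum>C\<in>Q. s A (inv (r C)) $$ (0, a A) * s A (r C) $$ (a A, 0)) \<noteq> 0"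
    by blast
  have "card \<A> \<le> card Q"
  proof (rule card_biorthogonal_le[OF finQ \<A>(2),
        where f = "\<lambda>A C. if C \<in> Q then s A (r C) $$ (a A, 0) else 0" 
          and w = "\<lambda>A C. s A (inv (r C)) $$ (0, a A)"])
    fix A B assume AB: "A \<in> \<A>" "B \<in> \<A>"
    have n: "0 < n" using finite_irrepsD(3)[OF s(2)[OF AB(1)]] .
    have "(\<Sum>C\<in>Q. s A (inv (r C)) $$ (0, a A) * (if C \<in> Q then s B (r C) $$ (a B, 0) else 0))
        = (\<Sum>C\<in>Q. s A (inv (r C)) $$ (0, a A) * s B (r C) $$ (a B, 0))" by (intro sum.cong) auto
    moreover have "(\<Sum>C\<in>Q. s A (inv (r C)) $$ (0, a A) * s B (r C) $$ (a B, 0)) = 0" if "A \<noteq> B"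
      unfolding Q_def
      by (rule averaged_coefficients[OF N s(2)[OF AB(2)] triv[OF s(2)[OF AB(2)]] s(2)[OF AB(1)] triv[OF s(2)[OF AB(1)]] r])
        (use a AB n ineq that in \<open>auto simp: Q_def\<close>)
    ultimately show "(\<Sum>C\<in>Q. s A (inv (r C)) $$ (0, a A) * (if C \<in> Q then s B (r C) $$ (a B, 0) else 0)) \<noteq> 0 \<longleftrightarrow> A = B"
      using a(2)[OF AB(1)] by auto
  qed (simp add: supp_space_def)
  then show False using \<A>(3) by (simp add: Q_def)
qed

section \<open>Virtually abelian groups\<close>

text \<open>The eigenspace of \<open>\<sigma> h\<close> for an eigenvalue \<open>c\<close> is
  invariant, because all matrices commute with \<open>\<sigma> h\<close>; it is nonzero, hence
  everything.\<close>

lemma scalar_if_comm_irreducible: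
  assumes H: "comm_group H" and irr: "irreducible_rep H k \<sigma>" and h: "h \<in> carrier H"
  shows "\<exists>c. \<sigma> h = c \<cdot>\<^sub>m 1\<^sub>m k"
proof -
  interpret H: comm_group H by (rule H)
  have hom: "\<sigma> \<in> hom H (GL k)" and k: "0 < k" using irr by (auto simp: irreducible_rep_def)
  note S = hom_GL_D[OF H.is_group hom]
  obtain c where "eigenvalue (\<sigma> h) c"
    using spectrum_non_empty[OF S(1)[OF h] k] by (auto simp: spectrum_def)
  then obtain v where v: "v \<in> carrier_vec k" "v \<noteq> 0\<^sub>v k" "\<sigma> h *\<^sub>v v = c \<cdot>\<^sub>v v"
    using S(1)[OF h] by (auto simp: eigenvalue_def eigenvector_def)
  define E where "E = {v \<in> carrier_vec k. \<sigma> h *\<^sub>v v = c \<cdot>\<^sub>v v}"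
  have "invariant_subspace H k \<sigma> E"
    unfolding invariant_subspace_def subspace_vec_iff
  proof (intro conjI ballI allI)
    show "E \<subseteq> carrier_vec k" "0\<^sub>v k \<in> E" using S(1)[OF h] by (auto simp: E_def)
    show "u + v \<in> E" if "u \<in> E" "v \<in> E" for u v
      using that S(1)[OF h] by (auto simp: E_def mult_add_distrib_mat_vec smult_add_distrib_vec)
    show "d \<cdot>\<^sub>v u \<in> E" if "u \<in> E" for d u
      using that S(1)[OF h] by (auto simp: E_def mult_mat_vec smult_smult_assoc mult.commute)
    show "\<sigma> g *\<^sub>v u \<in> E" if g: "g \<in> carrier H" and u: "u \<in> E" for g u
    proof -
      have u': "u \<in> carrier_vec k" "\<sigma> h *\<^sub>v u = c \<cdot>\<^sub>v u" using u by (auto simp: E_def)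
      have "\<sigma> h * \<sigma> g = \<sigma> g * \<sigma> h" using S(3) g h H.m_comm by metis
      then have "\<sigma> h *\<^sub>v (\<sigma> g *\<^sub>v u) = \<sigma> g *\<^sub>v (\<sigma> h *\<^sub>v u)"
        using S(1)[OF g] S(1)[OF h] u'(1) by (metis assoc_mult_mat_vec)
      also have "\<dots> = c \<cdot>\<^sub>v (\<sigma> g *\<^sub>v u)" using u' S(1)[OF g] by (simp add: mult_mat_vec)
      finally show ?thesis using u' S(1)[OF g] by (auto simp: E_def)
    qed
  qed
  moreover have "E \<noteq> {0\<^sub>v k}" using v by (auto simp: E_def)
  ultimately have E: "E = carrier_vec k" using irr unfolding irreducible_rep_def by blast
  have "\<sigma> h = c \<cdot>\<^sub>m 1\<^sub>m k"
  proof (rule mat_eq_if_mult_vec_eq[OF S(1)[OF h]])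
    show "c \<cdot>\<^sub>m 1\<^sub>m k \<in> carrier_mat k k" by simp
    fix v :: "complex vec" assume v: "v \<in> carrier_vec k"
    then have "\<sigma> h *\<^sub>v v = c \<cdot>\<^sub>v v" using E by (auto simp: E_def)
    also have "\<dots> = c \<cdot>\<^sub>m 1\<^sub>m k *\<^sub>v v" using v by (intro eq_vecI) auto
    finally show "\<sigma> h *\<^sub>v v = c \<cdot>\<^sub>m 1\<^sub>m k *\<^sub>v v" .
  qed
  then show ?thesis by blast
qed

lemma degree_le_index_if_abelian:
  assumes H: "finite_index G H" "comm_group (G\<lparr>carrier := H\<rparr>)" and \<sigma>: "\<sigma> \<in> finite_irreps G n"
  shows "n \<le> card (rcosets H)"
proof -
  have sH: "subgroup H G" using H by (simp add: finite_index_def)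
  have HG: "H \<subseteq> carrier G" using sH by (rule subgroup.subset)
  note irr = finite_irrepsD(1)[OF \<sigma>] and hom = finite_irrepsD(2)[OF \<sigma>]
  define F where "F = (supp_space {..<n} :: (nat \<Rightarrow> complex) set)"
  have lirr: "linear_irrep G (act n \<sigma>) F" unfolding F_def by (rule linear_irrep_act[OF is_group irr])
  then have "linear_rep G (act n \<sigma>) F" and F0: "F \<noteq> {0}" by (auto simp: linear_irrep_def)
  then have "linear_rep (G\<lparr>carrier := H\<rparr>) (act n \<sigma>) F"
    using HG by (simp add: linear_rep_def invariant_def subset_iff)
  \<comment> \<open>On an irreducible submodule for \<open>H\<close> the group acts by scalars, so
    its basis vector \<open>b 0\<close> is a common eigenvector.\<close>
  then obtain U where U: "U \<subseteq> F" "linear_irrep (G\<lparr>carrier := H\<rparr>) (act n \<sigma>) U"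
    using exists_irreducible_sub F0 by blast
  have gH: "Group.group (G\<lparr>carrier := H\<rparr>)" using H(2) by (simp add: comm_group_def)
  obtain k \<tau> b where \<tau>: "irreducible_rep (G\<lparr>carrier := H\<rparr>) k \<tau>"
    and b: "\<forall>i<k. b i \<in> U" "\<forall>w\<in>U. \<exists>c. w = (\<Sum>i<k. c i *f b i)"
    and act_b: "\<forall>g\<in>carrier (G\<lparr>carrier := H\<rparr>). \<forall>j<k. act n \<sigma> g (b j) = (\<Sum>i<k. \<tau> g $$ (i, j) *f b i)"
    and "\<forall>g\<in>carrier (G\<lparr>carrier := H\<rparr>). (\<forall>w\<in>U. act n \<sigma> g w = w) \<longrightarrow> \<tau> g = 1\<^sub>m k"
    and b0: "b 0 \<noteq> 0" and "\<forall>T. finite T \<longrightarrow> U \<subseteq> fn.span T \<longrightarrow> k \<le> card T"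
    by (rule irrep_matrix_form[OF gH U(2)])
  have k: "0 < k" using \<tau> by (simp add: irreducible_rep_def)
  have eig: "\<exists>c. act n \<sigma> h (b 0) = c *f b 0" if h: "h \<in> H" for h
  proof -
    obtain c where c: "\<tau> h = c \<cdot>\<^sub>m 1\<^sub>m k" using scalar_if_comm_irreducible[OF H(2) \<tau>] h by auto
    have "act n \<sigma> h (b 0) = (\<Sum>i<k. \<tau> h $$ (i, 0) *f b i)" using act_b h k by simp
    also have "\<dots> = (\<Sum>i<k. if i = 0 then c *f b 0 else 0)"
      using k by (intro sum.cong) (auto simp: c)
    finally show ?thesis using k by auto
  qed
  define r where "r C = (SOME x. x \<in> C)" for C :: "'a set"
  have r: "r C \<in> C" if "C \<in> rcosets H" for C
    unfolding r_def using subgroup.rcosets_non_empty[OF sH, of C] that by (simp add: some_in_eq)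
  have rG: "r C \<in> carrier G" if "C \<in> rcosets H" for C using r rcoset_subset[OF sH] that by blast
  define S where "S = (\<lambda>C. act n \<sigma> (inv (r C)) (b 0)) ` (rcosets H)"
  have orbit: "act n \<sigma> g (b 0) \<in> fn.span S" if g: "g \<in> carrier G" for g
  proof -
    \<comment> \<open>Inverses of right coset representatives represent left cosets:
      \<open>g = inv (r C) \<otimes> h\<close>, and \<open>h\<close> only rescales
      \<open>b 0\<close>.\<close>
    define C where "C = H #> inv g"
    have C: "C \<in> rcosets H" using g by (auto simp: C_def rcosets_image)
    have "r C \<in> H #> inv g" using r[OF C] by (simp add: C_def)
    then obtain h where h: "h \<in> H" "r C = h \<otimes> inv g" by (auto simp: r_coset_def)
    have hG: "h \<in> carrier G" using h HG by blast
    have "g = inv (r C) \<otimes> h" using h g hG by (simp add: inv_mult_group m_assoc)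
    then have "act n \<sigma> g (b 0) = act n \<sigma> (inv (r C)) (act n \<sigma> h (b 0))"
      using act_mult[OF is_group hom, of "inv (r C)" h] rG[OF C] hG by simp
    moreover obtain c where "act n \<sigma> h (b 0) = c *f b 0" using eig[OF h(1)] by blast
    ultimately have "act n \<sigma> g (b 0) = c *f act n \<sigma> (inv (r C)) (b 0)" by (simp add: act_scale)
    moreover have "act n \<sigma> (inv (r C)) (b 0) \<in> fn.span S" using C by (auto simp: S_def intro: fn.span_base)
    ultimately show ?thesis by (simp add: fn.span_scale)
  qed
  have "invariant G (act n \<sigma>) (fn.span S)"
  proof (rule invariant_span)
    fix g s assume g: "g \<in> carrier G" and "s \<in> S"
    then obtain C where C: "C \<in> rcosets H" "s = act n \<sigma> (inv (r C)) (b 0)" by (auto simp: S_def)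
    then have "act n \<sigma> g s = act n \<sigma> (g \<otimes> inv (r C)) (b 0)"
      using act_mult[OF is_group hom g, of "inv (r C)"] rG by simp
    then show "act n \<sigma> g s \<in> fn.span S" using orbit g rG[OF C(1)] by simp
  qed (simp_all add: act_add act_scale)
  moreover have "fn.span S \<subseteq> F" unfolding F_def
    by (intro fn.span_minimal subspace_supp_space) (auto simp: S_def act_in_supp_space)
  moreover have "fn.span S \<noteq> {0}"
  proof -
    have "b 0 \<in> F" using b k U by blast
    then have "act n \<sigma> \<one> (b 0) = b 0"
      unfolding F_def by (intro act_eq_self hom_GL_D(2)[OF is_group hom])
    then show ?thesis using orbit[OF one_closed] b0 by auto
  qed
  ultimately have "fn.span S = F" using lirr unfolding linear_irrep_def by blast
  moreover have finS: "finite S" using H by (simp add: S_def finite_index_def)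
  ultimately have "n \<le> card S"
    using card_spanning_supp_space[of "{..<n}" S] by (simp add: F_def)
  also have "\<dots> \<le> card (rcosets H)"
    unfolding S_def using H by (intro card_image_le) (simp add: finite_index_def)
  finally show ?thesis .
qed

section \<open>Tensor products\<close>

definition tensor_act :: "nat \<Rightarrow> ('a \<Rightarrow> complex mat) \<Rightarrow> nat \<Rightarrow> ('a \<Rightarrow> complex mat) \<Rightarrow> 'a \<Rightarrow>
    (nat \<times> nat \<Rightarrow> complex) \<Rightarrow> nat \<times> nat \<Rightarrow> complex" where
  "tensor_act n \<rho> k \<sigma> g F = (\<lambda>(i, c). act n \<rho> g (\<lambda>i'. act k \<sigma> g (\<lambda>c'. F (i', c')) c) i)"

text \<open>The two actions touch different indices and give the same double sum. Multiplicativity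
  of the tensor action rests on this exchange.\<close>

lemma act_commute:
  "act n \<rho> g (\<lambda>i. act k \<sigma> h (\<lambda>c. f i c) c) i = act k \<sigma> h (\<lambda>c. act n \<rho> g (\<lambda>i. f i c) i) c"
proof (cases "i < n \<and> c < k")
  case True
  have "(\<Sum>j<n. \<rho> g $$ (i, j) * (\<Sum>d<k. \<sigma> h $$ (c, d) * f j d)) =
      (\<Sum>j<n. \<Sum>d<k. \<rho> g $$ (i, j) * \<sigma> h $$ (c, d) * f j d)"
    by (simp add: sum_distrib_left mult.assoc)
  also have "\<dots> = (\<Sum>d<k. \<Sum>j<n. \<rho> g $$ (i, j) * \<sigma> h $$ (c, d) * f j d)" by (rule sum.swap)
  also have "\<dots> = (\<Sum>d<k. \<sigma> h $$ (c, d) * (\<Sum>j<n. \<rho> g $$ (i, j) * f j d))"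
    by (simp add: sum_distrib_left mult.assoc mult.left_commute)
  finally show ?thesis using True by (simp add: act_def)
qed (auto simp: act_def)

lemma tensor_act_mult:
  assumes \<rho>: "\<rho> \<in> hom G (GL n)" and \<sigma>: "\<sigma> \<in> hom G (GL k)" and g: "g \<in> carrier G" and h: "h \<in> carrier G"
  shows "tensor_act n \<rho> k \<sigma> (g \<otimes> h) F = tensor_act n \<rho> k \<sigma> g (tensor_act n \<rho> k \<sigma> h F)"
proof
  fix x :: "nat \<times> nat"
  obtain i c where x: "x = (i, c)" by force
  have "tensor_act n \<rho> k \<sigma> (g \<otimes> h) F x =
      act n \<rho> g (act n \<rho> h (\<lambda>i'. act k \<sigma> g (\<lambda>d. act k \<sigma> h (\<lambda>c'. F (i', c')) d) c)) i"
    by (simp add: tensor_act_def x act_mult[OF is_group \<rho> g h] act_mult[OF is_group \<sigma> g h])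
  also have "act n \<rho> h (\<lambda>i'. act k \<sigma> g (\<lambda>d. act k \<sigma> h (\<lambda>c'. F (i', c')) d) c) =
      (\<lambda>j. act k \<sigma> g (\<lambda>d. act n \<rho> h (\<lambda>i'. act k \<sigma> h (\<lambda>c'. F (i', c')) d) j) c)"
    by (rule ext) (rule act_commute)
  finally show "tensor_act n \<rho> k \<sigma> (g \<otimes> h) F x = tensor_act n \<rho> k \<sigma> g (tensor_act n \<rho> k \<sigma> h F) x"
    by (simp add: tensor_act_def x)
qed

lemma tensor_act_trivial:
  assumes "\<rho> g = 1\<^sub>m n" "\<sigma> g = 1\<^sub>m k" "F \<in> supp_space ({..<n} \<times> {..<k})"
  shows "tensor_act n \<rho> k \<sigma> g F = F"
proof -
  have "act k \<sigma> g (\<lambda>c'. F (i', c')) = (\<lambda>c'. F (i', c'))" for i'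
    by (rule act_eq_self[where \<sigma> = \<sigma> and g = g, OF assms(2)]) (use assms(3) in \<open>auto simp: supp_space_def\<close>)
  moreover have "act n \<rho> g (\<lambda>i'. F (i', c)) = (\<lambda>i'. F (i', c))" for c
    by (rule act_eq_self[where \<sigma> = \<rho> and g = g, OF assms(1)]) (use assms(3) in \<open>auto simp: supp_space_def\<close>)
  ultimately show ?thesis by (auto simp: tensor_act_def fun_eq_iff)
qed

lemma linear_rep_tensor_act:
  assumes \<rho>: "\<rho> \<in> hom G (GL n)" and \<sigma>: "\<sigma> \<in> hom G (GL k)"
  shows "linear_rep G (tensor_act n \<rho> k \<sigma>) (supp_space ({..<n} \<times> {..<k}))"
  unfolding linear_rep_def invariant_def
proof (intro conjI ballI allI exI)
  show "finite (delta ` ({..<n} \<times> {..<k}))" by simp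
  show "supp_space ({..<n} \<times> {..<k}) \<subseteq> fn.span (delta ` ({..<n} \<times> {..<k}))"
    by (rule supp_space_span) simp
  show "fn.subspace (supp_space ({..<n} \<times> {..<k}))" by (rule subspace_supp_space)
  show "tensor_act n \<rho> k \<sigma> g F \<in> supp_space ({..<n} \<times> {..<k})" for g F
    by (auto simp: tensor_act_def act_def supp_space_def)
  show "tensor_act n \<rho> k \<sigma> g (u + v) = tensor_act n \<rho> k \<sigma> g u + tensor_act n \<rho> k \<sigma> g v" for g u v
  proof
    fix x :: "nat \<times> nat"
    obtain i c where x: "x = (i, c)" by force
    show "tensor_act n \<rho> k \<sigma> g (u + v) x = (tensor_act n \<rho> k \<sigma> g u + tensor_act n \<rho> k \<sigma> g v) x"
      by (cases "c < k") (simp_all add: x tensor_act_def act_def algebra_simps sum.distrib sum_distrib_left)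
  qed
  show "tensor_act n \<rho> k \<sigma> g (c *f u) = c *f tensor_act n \<rho> k \<sigma> g u" for g c u
  proof
    fix x :: "nat \<times> nat"
    obtain i d where x: "x = (i, d)" by force
    show "tensor_act n \<rho> k \<sigma> g (c *f u) x = (c *f tensor_act n \<rho> k \<sigma> g u) x"
      by (cases "d < k") (simp_all add: x tensor_act_def act_def sum_distrib_left mult.left_commute)
  qed
  show "tensor_act n \<rho> k \<sigma> \<one> F = F" if "F \<in> supp_space ({..<n} \<times> {..<k})" for F
    by (rule tensor_act_trivial[where \<rho> = \<rho> and \<sigma> = \<sigma> and g = \<one>,
        OF hom_GL_D(2)[OF is_group \<rho>] hom_GL_D(2)[OF is_group \<sigma>] that])
  show "tensor_act n \<rho> k \<sigma> (g \<otimes> h) F = tensor_act n \<rho> k \<sigma> g (tensor_act n \<rho> k \<sigma> h F)"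
    if "g \<in> carrier G" "h \<in> carrier G" for g h F
    by (rule tensor_act_mult[OF \<rho> \<sigma> that])
qed

text \<open>For an irreducible submodule \<open>U\<close> of \<open>\<rho> \<otimes> \<sigma>\<close>, realised on \<open>n \<times> k\<close> matrices, the columns of the
  matrices in \<open>U\<close> span a \<open>\<rho>\<close>-invariant space, since \<open>\<rho> g\<close> differs from the action of \<open>g\<close> on \<open>U\<close> by
  column operations.\<close>

lemma columns_span:
  assumes \<rho>: "irreducible_rep G n \<rho>" and \<sigma>: "\<sigma> \<in> hom G (GL k)"
    and U: "U \<subseteq> supp_space ({..<n} \<times> {..<k})" "U \<noteq> {0}" "invariant G (tensor_act n \<rho> k \<sigma>) U"
  shows "supp_space {..<n} \<subseteq> fn.span ((\<lambda>(F, c). (\<lambda>i. F (i, c))) ` (U \<times> {..<k}))" (is "_ \<subseteq> fn.span ?S")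
proof -
  have hom: "\<rho> \<in> hom G (GL n)" using \<rho> by (simp add: irreducible_rep_def)
  have "invariant G (act n \<rho>) (fn.span ?S)"
  proof (rule invariant_span)
    fix g s assume g: "g \<in> carrier G" and "s \<in> ?S"
    then obtain F c where F: "F \<in> U" "c < k" "s = (\<lambda>i. F (i, c))" by auto
    define H where "H = tensor_act n \<rho> k \<sigma> g F"
    have HU: "H \<in> U" using U g F by (simp add: H_def invariant_def)
    \<comment> \<open>\<open>H\<close> is \<open>F\<close> with both actions of \<open>g\<close>
      applied. Undoing \<open>\<sigma> g\<close> by \<open>\<sigma> (inv g)\<close> expresses
      \<open>\<rho> g\<close> on column \<open>c\<close> of \<open>F\<close> through the columns of
      \<open>H\<close>.\<close>
    have "act n \<rho> g s = (\<Sum>d<k. \<sigma> (inv g) $$ (c, d) *f (\<lambda>i. H (i, d)))"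
    proof
      fix i
      have "(\<lambda>d. H (i, d)) = act k \<sigma> g (\<lambda>d. act n \<rho> g (\<lambda>i'. F (i', d)) i)"
        by (rule ext) (simp add: H_def tensor_act_def act_commute[of n \<rho> g k \<sigma> g "\<lambda>i c. F (i, c)"])
      then have "act k \<sigma> (inv g) (\<lambda>d. H (i, d)) = act k \<sigma> \<one> (\<lambda>d. act n \<rho> g (\<lambda>i'. F (i', d)) i)"
        using act_mult[OF is_group \<sigma>, of "inv g" g] g by simp
      also have "\<dots> = (\<lambda>d. act n \<rho> g (\<lambda>i'. F (i', d)) i)"
        by (rule act_eq_self[where \<sigma> = \<sigma> and g = \<one>, OF hom_GL_D(2)[OF is_group \<sigma>]])
          (use F U(1) in \<open>auto simp: supp_space_def act_def subset_iff\<close>)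
      finally have "act n \<rho> g s i = act k \<sigma> (inv g) (\<lambda>d. H (i, d)) c" using F by metis
      then show "act n \<rho> g s i = (\<Sum>d<k. \<sigma> (inv g) $$ (c, d) *f (\<lambda>i. H (i, d))) i"
        using F by (simp add: act_def[of k] sum_fun_apply)
    qed
    also have "\<dots> \<in> fn.span ?S"
      using HU by (intro fn.span_sum fn.span_scale fn.span_base) force
    finally show "act n \<rho> g s \<in> fn.span ?S" .
  qed (simp_all add: act_add act_scale)
  moreover have "fn.span ?S \<subseteq> supp_space {..<n}"
    using U(1) by (intro fn.span_minimal subspace_supp_space) (auto simp: supp_space_def)
  moreover have "fn.span ?S \<noteq> {0}"
  proof -
    have "0 \<in> U" using U(3) by (simp add: invariant_def fn.subspace_0)
    then obtain F where F: "F \<in> U" "F \<noteq> 0" using U(2) by blast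
    then obtain i c where ic: "F (i, c) \<noteq> 0" by (auto simp: fun_eq_iff)
    then have "(i, c) \<in> {..<n} \<times> {..<k}" using F U(1) unfolding supp_space_def by blast
    then have "(\<lambda>i. F (i, c)) \<in> ?S" using F by force
    then have "(\<lambda>i. F (i, c)) \<in> fn.span ?S" by (rule fn.span_base)
    moreover have "(\<lambda>i. F (i, c)) \<noteq> 0" using ic by (auto simp: fun_eq_iff)
    ultimately show ?thesis by blast
  qed
  ultimately show ?thesis
    using linear_irrep_act[OF is_group \<rho>] unfolding linear_irrep_def by blast
qed

text \<open>The \<open>t\<close> basis matrices of the constituent have \<open>t * k\<close>
  columns, which span the space of \<open>\<rho>\<close>; this gives \<open>n \<le> t * k\<close>.
  The vector \<open>f\<close> is a nonzero row of the matrix \<open>b 0\<close>: when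
  \<open>\<tau> g\<close> and \<open>\<rho> g\<close> are trivial, \<open>g\<close> fixes
  \<open>b 0\<close> and acts on it through \<open>\<sigma> g\<close> alone, hence fixes each
  row.\<close>

lemma tensor_constituent:
  assumes \<rho>: "\<rho> \<in> finite_irreps G n" and \<sigma>: "\<sigma> \<in> finite_irreps G k"
  shows "\<exists>t \<tau>. \<tau> \<in> finite_irreps G t \<and> n \<le> t * k \<and> t \<le> n * k \<and>
    (\<exists>f\<in>supp_space {..<k}. f \<noteq> 0 \<and> (\<forall>g\<in>carrier G. \<tau> g = 1\<^sub>m t \<longrightarrow> \<rho> g = 1\<^sub>m n \<longrightarrow> act k \<sigma> g f = f))"
proof -
  define E where "E = (supp_space ({..<n} \<times> {..<k}) :: (nat \<times> nat \<Rightarrow> complex) set)"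
  note hom = finite_irrepsD(2)[OF \<rho>] finite_irrepsD(2)[OF \<sigma>]
  have rep: "linear_rep G (tensor_act n \<rho> k \<sigma>) E" unfolding E_def by (rule linear_rep_tensor_act[OF hom])
  have "delta (0, 0) \<in> E"
    using finite_irrepsD(3)[OF \<rho>] finite_irrepsD(3)[OF \<sigma>] by (auto simp: E_def supp_space_def delta_def)
  moreover have "delta (0::nat, 0::nat) \<noteq> 0" by (auto simp: delta_def fun_eq_iff)
  ultimately have "E \<noteq> {0}" by blast
  then obtain U where U: "U \<subseteq> E" "linear_irrep G (tensor_act n \<rho> k \<sigma>) U"
    using exists_irreducible_sub[OF rep] by blast
  have Uinv: "U \<noteq> {0}" "invariant G (tensor_act n \<rho> k \<sigma>) U"
    using U(2) by (auto simp: linear_irrep_def linear_rep_def)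
  obtain t \<tau> b where \<tau>: "irreducible_rep G t \<tau>"
    and b: "\<forall>i<t. b i \<in> U" "\<forall>w\<in>U. \<exists>c. w = (\<Sum>i<t. c i *f b i)"
    and act_b: "\<forall>g\<in>carrier G. \<forall>j<t. tensor_act n \<rho> k \<sigma> g (b j) = (\<Sum>i<t. \<tau> g $$ (i, j) *f b i)"
    and triv: "\<forall>g\<in>carrier G. (\<forall>w\<in>U. tensor_act n \<rho> k \<sigma> g w = w) \<longrightarrow> \<tau> g = 1\<^sub>m t"
    and b0: "b 0 \<noteq> 0" and t_le: "\<forall>T. finite T \<longrightarrow> U \<subseteq> fn.span T \<longrightarrow> t \<le> card T"
    by (rule irrep_matrix_form[OF is_group U(2)])
  have t: "0 < t" using \<tau> by (simp add: irreducible_rep_def)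
  have "\<tau> \<in> finite_irreps G t"
  proof (rule finite_irrepsI[OF \<tau> finite_index_Int[OF finite_irrepsD(5)[OF \<rho>] finite_irrepsD(5)[OF \<sigma>]]])
    fix g assume "g \<in> kernel G (GL n) \<rho> \<inter> kernel G (GL k) \<sigma>"
    then have "g \<in> carrier G" "\<rho> g = 1\<^sub>m n" "\<sigma> g = 1\<^sub>m k"
      using finite_irrepsD(6)[OF \<rho>] finite_irrepsD(6)[OF \<sigma>] by auto
    then show "\<tau> g = 1\<^sub>m t" using triv tensor_act_trivial U(1) unfolding E_def by blast
  qed
  moreover have "n \<le> t * k"
  proof -
    let ?T = "(\<lambda>(a, c). (\<lambda>i. b a (i, c))) ` ({..<t} \<times> {..<k})"
    have "(\<lambda>i. F (i, c)) \<in> fn.span ?T" if F: "F \<in> U" and c: "c < k" for F c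
    proof -
      obtain u where u: "F = (\<Sum>a<t. u a *f b a)" using b(2) F by blast
      have "(\<lambda>i. F (i, c)) = (\<Sum>a<t. u a *f (\<lambda>i. b a (i, c)))"
        by (rule ext) (simp add: u sum_fun_apply)
      also have "\<dots> \<in> fn.span ?T" using c by (intro fn.span_sum fn.span_scale fn.span_base) force
      finally show ?thesis .
    qed
    then have "(\<lambda>(F, c). (\<lambda>i. F (i, c))) ` (U \<times> {..<k}) \<subseteq> fn.span ?T" by auto
    then have "supp_space {..<n} \<subseteq> fn.span ?T"
      using columns_span[OF finite_irrepsD(1)[OF \<rho>] hom(2) U(1)[unfolded E_def] Uinv]
        fn.span_minimal[OF _ fn.subspace_span] by (meson order_trans)
    then have "n \<le> card ?T" using card_spanning_supp_space[of "{..<n}" ?T] by simp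
    also have "\<dots> \<le> t * k"
      using card_image_le[of "{..<t} \<times> {..<k}"] by (metis card_cartesian_product card_lessThan finite_SigmaI finite_lessThan)
    finally show ?thesis .
  qed
  moreover have "t \<le> n * k"
  proof -
    have "U \<subseteq> fn.span (delta ` ({..<n} \<times> {..<k}))"
      using U(1) supp_space_span[of "{..<n} \<times> {..<k}"] unfolding E_def by auto
    then have "t \<le> card (delta ` ({..<n} \<times> {..<k}))" using t_le by simp
    also have "\<dots> \<le> n * k" using card_image_le[of "{..<n} \<times> {..<k}" delta] by simp
    finally show ?thesis .
  qed
  moreover have "\<exists>f\<in>supp_space {..<k}. f \<noteq> 0 \<and> (\<forall>g\<in>carrier G. \<tau> g = 1\<^sub>m t \<longrightarrow> \<rho> g = 1\<^sub>m n \<longrightarrow> act k \<sigma> g f = f)"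
  proof -
    have "\<exists>x. b 0 x \<noteq> 0" using b0 by (auto simp: fun_eq_iff)
    then obtain i c where ic: "b 0 (i, c) \<noteq> 0" by (metis surj_pair)
    define f where "f = (\<lambda>c. b 0 (i, c))"
    have bE: "b 0 \<in> supp_space ({..<n} \<times> {..<k})" using b(1) t U(1) by (auto simp: E_def)
    have "(i, c) \<in> {..<n} \<times> {..<k}" using ic bE unfolding supp_space_def by blast
    then have i: "i < n" by simp
    have "act k \<sigma> g f = f" if g: "g \<in> carrier G" "\<tau> g = 1\<^sub>m t" "\<rho> g = 1\<^sub>m n" for g
    proof
      fix c
      have "tensor_act n \<rho> k \<sigma> g (b 0) = (\<Sum>i<t. if i = 0 then b 0 else 0)"
      proof -
        have "tensor_act n \<rho> k \<sigma> g (b 0) = (\<Sum>i<t. \<tau> g $$ (i, 0) *f b i)" using act_b g t by blast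
        also have "\<dots> = (\<Sum>i<t. if i = 0 then b 0 else 0)"
          using g t by (intro sum.cong) auto
        finally show ?thesis .
      qed
      then have "b 0 (i, c) = tensor_act n \<rho> k \<sigma> g (b 0) (i, c)" using t by simp
      also have "\<dots> = act k \<sigma> g (\<lambda>c'. act n \<rho> g (\<lambda>i'. b 0 (i', c')) i) c"
        by (simp add: tensor_act_def act_commute[of n \<rho> g k \<sigma> g "\<lambda>i c. b 0 (i, c)"])
      also have "(\<lambda>c'. act n \<rho> g (\<lambda>i'. b 0 (i', c')) i) = (\<lambda>c'. b 0 (i, c'))"
      proof
        fix c'
        have "act n \<rho> g (\<lambda>i'. b 0 (i', c')) = (\<lambda>i'. b 0 (i', c'))"
          by (rule act_eq_self[where \<sigma> = \<rho> and g = g, OF g(3)]) (use bE in \<open>auto simp: supp_space_def\<close>)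
        then show "act n \<rho> g (\<lambda>i'. b 0 (i', c')) i = b 0 (i, c')" by metis
      qed
      finally show "act k \<sigma> g f c = f c" by (simp add: f_def)
    qed
    moreover have "f \<in> supp_space {..<k}" using bE by (auto simp: f_def supp_space_def)
    moreover have "f \<noteq> 0" using ic by (auto simp: f_def fun_eq_iff)
    ultimately show ?thesis by blast
  qed
  ultimately show ?thesis by blast
qed

text \<open>As \<open>N\<close> is normal, the vectors fixed by \<open>N\<close> form a
  \<open>G\<close>-invariant subspace. It contains \<open>f\<close>, so irreducibility makes it
  everything.\<close>

lemma normal_fixes_all:
  assumes \<sigma>: "\<sigma> \<in> finite_irreps G k" and N: "N \<lhd> G"
    and f: "f \<in> supp_space {..<k}" "f \<noteq> 0" "\<And>g. g \<in> N \<Longrightarrow> act k \<sigma> g f = f" and g: "g \<in> N"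
  shows "\<sigma> g = 1\<^sub>m k"
proof -
  note hom = finite_irrepsD(2)[OF \<sigma>]
  have NG: "N \<subseteq> carrier G" using normal_imp_subgroup[OF N] by (rule subgroup.subset)
  define V where "V = {w \<in> supp_space {..<k}. \<forall>g\<in>N. act k \<sigma> g w = w}"
  have "invariant G (act k \<sigma>) V"
    unfolding invariant_def
  proof (intro conjI ballI fn.subspaceI)
    have "act k \<sigma> g 0 = 0" for g by (auto simp: act_def fun_eq_iff)
    then show "0 \<in> V" using fn.subspace_0[OF subspace_supp_space] by (simp add: V_def)
    show "u + v \<in> V" if "u \<in> V" "v \<in> V" for u v
      using that fn.subspace_add[OF subspace_supp_space] by (auto simp: V_def act_add)
    show "c *f u \<in> V" if "u \<in> V" for c u
      using that fn.subspace_scale[OF subspace_supp_space] by (auto simp: V_def act_scale)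
    show "act k \<sigma> h w \<in> V" if h: "h \<in> carrier G" and w: "w \<in> V" for h w
    proof -
      have "act k \<sigma> g (act k \<sigma> h w) = act k \<sigma> h w" if g: "g \<in> N" for g
      proof -
        have gG: "g \<in> carrier G" using g NG by blast
        define m where "m = inv h \<otimes> g \<otimes> h"
        have m: "m \<in> N" using N g h unfolding m_def by (metis normal_inv_iff inv_closed inv_inv)
        have mG: "m \<in> carrier G" using m NG by blast
        have "g \<otimes> h = h \<otimes> m" using gG h by (simp add: m_def m_assoc[symmetric])
        then have "act k \<sigma> g (act k \<sigma> h w) = act k \<sigma> h (act k \<sigma> m w)"
          using act_mult[OF is_group hom] gG h mG by metis
        then show ?thesis using m w by (simp add: V_def)
      qed
      then show ?thesis by (simp add: V_def act_in_supp_space)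
    qed
  qed
  moreover have "V \<noteq> {0}" using f by (auto simp: V_def)
  moreover have "V \<subseteq> supp_space {..<k}" by (auto simp: V_def)
  ultimately have "V = supp_space {..<k}"
    using linear_irrep_act[OF is_group finite_irrepsD(1)[OF \<sigma>]] unfolding linear_irrep_def by blast
  then show ?thesis
    using g NG hom_GL_D(1)[OF is_group hom] by (intro eq_one_if_act_trivial) (auto simp: V_def)
qed

section \<open>Infinite degrees and bounded degrees\<close>

lemma degrees_bounded_if_finite_infinite_degrees:
  assumes fin: "finite (infinite_degrees G)" and ne: "infinite_degrees G \<noteq> {}"
  shows "\<exists>d. \<forall>n\<ge>d. finite_irreps G n = {}"
proof (rule ccontr)
  assume unb: "\<not> ?thesis"
  obtain k where k: "k \<in> infinite_degrees G" using ne by blast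
  then have k1: "1 \<le> k" "num_irreps G k = \<infinity>" by (auto simp: infinite_degrees_def)
  obtain M where M: "\<And>i. i \<in> infinite_degrees G \<Longrightarrow> i \<le> M"
    using fin unfolding finite_nat_set_iff_bounded_le by blast
  \<comment> \<open>With \<open>n > M * k\<close>, the bound \<open>n \<le> t * k\<close> forces
    \<open>t > M\<close>, so no constituent degree lies in
    \<open>infinite_degrees G\<close>.\<close>
  obtain n \<rho> where n: "Suc (M * k) \<le> n" and \<rho>: "\<rho> \<in> finite_irreps G n" using unb by blast
  have "num_irreps G t \<noteq> \<infinity>" if "t \<in> {Suc M..n * k}" for t
    using that M[of t] by (auto simp: infinite_degrees_def)
  then obtain K where K: "K \<lhd> G" "finite_index G K"
      "\<And>t \<tau> g. t \<in> {Suc M..n * k} \<Longrightarrow> \<tau> \<in> finite_irreps G t \<Longrightarrow> g \<in> K \<Longrightarrow> \<tau> g = 1\<^sub>m t"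
    using common_kernel[of "{Suc M..n * k}"] by blast
  \<comment> \<open>The intersection of \<open>K\<close> with the kernel of \<open>\<rho>\<close>,
    indexed by \<open>bool\<close>. On it both \<open>\<rho>\<close> and the constituent
    \<open>\<tau>\<close> are trivial.\<close>
  define N where "N = carrier G \<inter> (\<Inter>b\<in>UNIV. if b then K else kernel G (GL n) \<rho>)"
  have N: "N \<lhd> G" "finite_index G N"
    unfolding N_def
    by (rule normal_INT, use K finite_irrepsD(4)[OF \<rho>] in simp)
      (rule finite_index_INT, use K finite_irrepsD(5)[OF \<rho>] in simp_all)
  have NK: "g \<in> carrier G" "g \<in> K" "\<rho> g = 1\<^sub>m n" if "g \<in> N" for g
    using that finite_irrepsD(6)[OF \<rho>] by (auto simp: N_def split: if_splits)
  have "\<sigma> g = 1\<^sub>m k" if \<sigma>: "\<sigma> \<in> finite_irreps G k" and g: "g \<in> N" for \<sigma> g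
  proof -
    obtain t \<tau> f where t: "\<tau> \<in> finite_irreps G t" "n \<le> t * k" "t \<le> n * k"
      and f: "f \<in> supp_space {..<k}" "f \<noteq> 0"
        "\<forall>g\<in>carrier G. \<tau> g = 1\<^sub>m t \<longrightarrow> \<rho> g = 1\<^sub>m n \<longrightarrow> act k \<sigma> g f = f"
      using tensor_constituent[OF \<rho> \<sigma>] by blast
    have "M * k < t * k" using n t by (meson Suc_le_lessD order_less_le_trans)
    then have "t \<in> {Suc M..n * k}" using t by simp
    then have \<tau>: "\<tau> h = 1\<^sub>m t" if "h \<in> N" for h using K(3) t(1) NK that by blast
    have "act k \<sigma> h f = f" if h: "h \<in> N" for h
      using f(3) \<tau>[OF h] NK(1)[OF h] NK(3)[OF h] by simp
    then show ?thesis by (rule normal_fixes_all[OF \<sigma> N(1) f(1,2) _ g])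
  qed
  then have "num_irreps G k \<noteq> \<infinity>" by (rule finitely_many_irreps_of_quotient[OF N])
  then show False using k1 by simp
qed

lemma infinite_degrees_nonempty:
  assumes rf: "residually_finite G" and inf: "infinite (carrier G)"
    and d: "\<And>n. d \<le> n \<Longrightarrow> finite_irreps G n = {}"
  shows "infinite_degrees G \<noteq> {}"
proof
  assume e: "infinite_degrees G = {}"
  have "num_irreps G i \<noteq> \<infinity>" if "i \<in> {1..<d}" for i using e that by (auto simp: infinite_degrees_def)
  then obtain K where K: "finite_index G K"
      "\<And>i \<sigma> g. i \<in> {1..<d} \<Longrightarrow> \<sigma> \<in> finite_irreps G i \<Longrightarrow> g \<in> K \<Longrightarrow> \<sigma> g = 1\<^sub>m i"
    using common_kernel[of "{1..<d}"] by blast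
  have sK: "subgroup K G" using K by (simp add: finite_index_def)
  have "g = \<one>" if g: "g \<in> K" for g
  proof (rule irreps_separate[OF rf])
    show "g \<in> carrier G" using g sK by (meson subgroup.mem_carrier)
    fix k \<sigma> assume \<sigma>: "\<sigma> \<in> finite_irreps G k"
    then have "k \<in> {1..<d}" using d[of k] finite_irrepsD(3)[OF \<sigma>] by (cases "d \<le> k") auto
    then show "\<sigma> g = 1\<^sub>m k" using K(2) \<sigma> g by blast
  qed
  \<comment> \<open>\<open>K\<close> is trivial, so the identity map is constant on its cosets and
    has finite image.\<close>
  then have "finite ((\<lambda>x. x) ` carrier G)"
    by (intro finite_image_if_finite_index[OF K(1)]) (metis inv_equality inv_inv inv_closed)
  then show False using inf by simp
qed

end

theorem theoremB:
  fixes G :: "('a, 'b) monoid_scheme"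
  assumes "Group.group G"
    and "infinite (carrier G)"
    and "finitely_generated G"
    and "residually_finite G"
  shows "((finite (infinite_degrees G) \<and> infinite_degrees G \<noteq> {})
            \<longleftrightarrow> (\<exists>N. \<forall>i \<ge> N. num_irreps G i = 0))
       \<and> ((\<exists>N. \<forall>i \<ge> N. num_irreps G i = 0) \<longleftrightarrow> virtually_abelian G)"
proof -
  interpret Group.group G by (rule assms(1))
  define bounded where "bounded \<longleftrightarrow> (\<exists>N. \<forall>i \<ge> N. num_irreps G i = 0)"
  have bounded_iff: "bounded \<longleftrightarrow> (\<exists>N. \<forall>i \<ge> N. finite_irreps G i = {})"
    by (simp add: bounded_def num_irreps_eq_0_iff)
  have "bounded" if "finite (infinite_degrees G)" "infinite_degrees G \<noteq> {}"
    using degrees_bounded_if_finite_infinite_degrees[OF that] by (simp add: bounded_iff)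
  moreover have "finite (infinite_degrees G) \<and> infinite_degrees G \<noteq> {}" if bd: bounded
  proof -
    obtain N where N: "\<And>i. N \<le> i \<Longrightarrow> finite_irreps G i = {}" using bd by (auto simp: bounded_iff)
    have "i < N" if "i \<in> infinite_degrees G" for i
    proof (rule ccontr)
      assume "\<not> i < N"
      then have "num_irreps G i = 0" using N by (simp add: num_irreps_eq_0_iff)
      then show False using that by (simp add: infinite_degrees_def)
    qed
    then have "infinite_degrees G \<subseteq> {..<N}" by blast
    then show ?thesis
      using infinite_degrees_nonempty[OF assms(4,2) N] finite_subset by blast
  qed
  moreover have "virtually_abelian G" if bd: bounded
  proof -
    obtain d where d: "\<And>i. d \<le> i \<Longrightarrow> finite_irreps G i = {}" using bd by (auto simp: bounded_iff)
    have "finite_index G FC_centre"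
      using reorderable_if_degrees_bounded[OF assms(4) d]
      by (intro finite_index_FC_centre_if_reorderable[of "d * d + 1"]) blast
    then show ?thesis by (rule virtually_abelian_if_finite_index_FC_centre[OF assms(3)])
  qed
  moreover have bounded if va: "virtually_abelian G"
  proof -
    obtain H where H: "finite_index G H" "comm_group (G\<lparr>carrier := H\<rparr>)"
      using va by (auto simp: virtually_abelian_def)
    \<comment> \<open>Degrees may equal the index of \<open>H\<close>, so the vanishing range starts
      one above it.\<close>
    then have "\<forall>i \<ge> Suc (card (rcosets\<^bsub>G\<^esub> H)). finite_irreps G i = {}"
      using degree_le_index_if_abelian[OF H] by fastforce
    then show ?thesis unfolding bounded_iff by blast
  qed
  ultimately show ?thesis unfolding bounded_def by blast
qed

end
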